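(* Let $1/2<H<1$, $x\in\mathbb R^d$, and let $b=(b^1,\dots,b^d):\mathbb R^d\to\mathbb R^d$ and $\sigma=(\sigma^{i,j}):[0,T]\to\mathbb R^{d\times m}$ satisfy: (i) there exists a constant $L_b$ such that $|b(z)-b(z')|\le L_b|z-z'|$ for all $z,z'\in\mathbb R^d$; (ii) there exists $\beta>1-H$ such that $\sigma\in C^\beta(0,T;\mathbb R^{d\times m})$. Let $\mathbb P_x$ be the law of the solution $(X_t)_{t\in[0,T]}$ of $$X^i_t=x^i+\int_0^t b^i(X_s)\,\mathrm ds+\sum_{j=1}^m\int_0^t\sigma^{i,j}(s)\,\mathrm dB^{H,j}_s,\qquad t\in[0,T],\ i=1,\dots,d.$$ Then, for each $0<T\le (2L_b)^{-1}\wedge 1$, there exists a universal constant $K$, independent of the initial point $x$, such that $\mathbb P_x$ satisfies the property $T_1\big(K\,\|\sigma\|_\beta^2\,T^{2H}\big)$ on the space $C(0,T;\mathbb R^d)$ equipped with the metric $d_\infty(\gamma_1,\gamma_2)=\sup_{0\le t\le T}|\gamma_1(t)-\gamma_2(t)|$.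
   Context: Fractional Brownian motion: $B^H=(B^{H,1},\dots,B^{H,m})$ is an $m$-dimensional fractional Brownian motion with Hurst parameter $H$ on a complete filtered probability space, i.e. its components are independent centered Gaussian processes with covariance $R_H(s,t)=\frac12(t^{2H}+s^{2H}-|t-s|^{2H})$. Stochastic integrals are pathwise Riemann--Stieltjes (Young) integrals. Under the stated assumptions the equation has a unique adapted solution whose trajectories are Hölder continuous of order $H-\epsilon$ for every $\epsilon>0$. Hölder norms: for $0<\lambda\le1$, $C^\lambda(0,T;E)$ is the space of $\lambda$-Hölder continuous functions $f:[0,T]\to E$ ($E$ a Euclidean space with norm $|\cdot|$), with norm $\|f\|_\lambda=\|f\|_{0,T,\infty}+\|f\|_{0,T,\lambda}$, where $\|f\|_{0,T,\infty}=\sup_{0\le r\le T}|f(r)|$ and $\|f\|_{0,T,\lambda}=\sup_{0\le r<s\le T}\frac{|f(s)-f(r)|}{|s-r|^\lambda}$. $C(0,T;\mathbb R^d)$ is the space of continuous functions $[0,T]\to\mathbb R^d$. Transportation inequality: for probability measures $\mu,\nu$ on a metric space $(E,d)$ and $p\ge1$, $W_p^d(\mu,\nu)=\inf_\pi\big(\iint d(x,y)^p\,\mathrm d\pi(x,y)\big)^{1/p}$, the infimum being over probability measures $\pi$ on $E\times E$ with marginals $\mu$ and $\nu$. The relative entropy is $\mathbf H(\nu/\mu)=\int\log\frac{\mathrm d\nu}{\mathrm d\mu}\,\mathrm d\nu$ if $\nu\ll\mu$ and $+\infty$ otherwise. For $C\ge0$, $\mu$ satisfies $T_p(C)$ on $(E,d)$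 if $W_p^d(\mu,\nu)\le\sqrt{2C\,\mathbf H(\nu/\mu)}$ for every probability measure $\nu$ on $E$. *)

theory Defs
  imports "HOL-Probability.Probability"
begin

text \<open>For \<open>'a = real ^ 'm ^ 'd\<close> the library norm is the Euclidean (Frobenius) norm of a matrix.\<close>

definition holder_space :: "real \<Rightarrow> real \<Rightarrow> (real \<Rightarrow> 'a::euclidean_space) set" where
  "holder_space lam T =
     {f. \<exists>C. \<forall>r\<in>{0..T}. \<forall>s\<in>{0..T}. norm (f s - f r) \<le> C * \<bar>s - r\<bar> powr lam}"

definition sup_norm :: "real \<Rightarrow> (real \<Rightarrow> 'a::euclidean_space) \<Rightarrow> real" where
  "sup_norm T f = (SUP r\<in>{0..T}. norm (f r))"

definition holder_seminorm :: "real \<Rightarrow> real \<Rightarrow> (real \<Rightarrow> 'a::euclidean_space) \<Rightarrow> real" where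
  "holder_seminorm lam T f =
     (SUP (r, s)\<in>{(r, s). 0 \<le> r \<and> r < s \<and> s \<le> T}. norm (f s - f r) / \<bar>s - r\<bar> powr lam)"

definition holder_norm :: "real \<Rightarrow> real \<Rightarrow> (real \<Rightarrow> 'a::euclidean_space) \<Rightarrow> real" where
  "holder_norm lam T f = sup_norm T f + holder_seminorm lam T f"

text \<open>A path on \<open>[0, T]\<close> is represented by the function that is \<open>undefined\<close> outside \<open>[0, T]\<close>,
  so that equality of representatives is equality of paths.\<close>

definition paths :: "real \<Rightarrow> (real \<Rightarrow> 'a::euclidean_space) set" where
  "paths T = {f \<in> extensional {0..T}. continuous_on {0..T} f}"

text \<open>The value 0 outside \<open>paths T\<close> is irrelevant; it is only there because the locale
  \<open>Metric_space\<close> wants a distance that is nonnegative on the whole type.\<close>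

definition d_infty :: "real \<Rightarrow> (real \<Rightarrow> 'a::euclidean_space) \<Rightarrow> (real \<Rightarrow> 'a) \<Rightarrow> real" where
  "d_infty T f g =
     (if f \<in> paths T \<and> g \<in> paths T then SUP t\<in>{0..T}. norm (f t - g t) else 0)"

definition path_space :: "real \<Rightarrow> (real \<Rightarrow> 'a::euclidean_space) metric" where
  "path_space T = metric (paths T, d_infty T)"

lemma norm_le_d_infty:
  assumes "f \<in> paths T" "g \<in> paths T" "t \<in> {0..T}"
  shows "norm (f t - g t) \<le> d_infty T f g"
proof -
  have "continuous_on {0..T} (\<lambda>t. norm (f t - g t))"
    using assms by (auto simp: paths_def intro!: continuous_intros)
  then have "bdd_above ((\<lambda>t. norm (f t - g t)) ` {0..T})"
    by (intro bounded_imp_bdd_above compact_imp_bounded compact_continuous_image) auto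
  then have "norm (f t - g t) \<le> (SUP t\<in>{0..T}. norm (f t - g t))"
    using assms(3) by (intro cSUP_upper) auto
  then show ?thesis
    using assms by (simp add: d_infty_def)
qed

lemma d_infty_le:
  assumes "0 \<le> T" "f \<in> paths T" "g \<in> paths T"
    and "\<And>t. t \<in> {0..T} \<Longrightarrow> norm (f t - g t) \<le> c"
  shows "d_infty T f g \<le> c"
  using assms by (auto simp: d_infty_def intro!: cSUP_least)

lemma Metric_space_paths:
  assumes T: "0 \<le> T"
  shows "Metric_space (paths T :: (real \<Rightarrow> 'a::euclidean_space) set) (d_infty T)"
proof
  have T0: "0 \<in> {0..T}" using T by auto
  fix f g h :: "real \<Rightarrow> 'a"
  show "0 \<le> d_infty T f g"
  proof (cases "f \<in> paths T \<and> g \<in> paths T")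
    case True
    then show ?thesis
      using norm_le_d_infty[OF _ _ T0, of f g] norm_ge_zero order_trans by blast
  qed (auto simp: d_infty_def)
  show "d_infty T f g = d_infty T g f"
    by (auto simp: d_infty_def norm_minus_commute)
  assume fg: "f \<in> paths T" "g \<in> paths T"
  show "d_infty T f g = 0 \<longleftrightarrow> f = g"
  proof
    assume "d_infty T f g = 0"
    then have "f t = g t" if "t \<in> {0..T}" for t
      using norm_le_d_infty[OF fg that] by simp
    then show "f = g"
      using fg by (intro extensionalityI[of f "{0..T}" g]) (auto simp: paths_def)
  next
    assume "f = g"
    then show "d_infty T f g = 0"
      using fg T by (simp add: d_infty_def)
  qed
  assume h: "h \<in> paths T"
  show "d_infty T f h \<le> d_infty T f g + d_infty T g h"
  proof (rule d_infty_le[OF T fg(1) h])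
    fix t assume t: "t \<in> {0..T}"
    have "norm (f t - h t) \<le> norm (f t - g t) + norm (g t - h t)"
      using norm_triangle_ineq[of "f t - g t" "g t - h t"] by simp
    then show "norm (f t - h t) \<le> d_infty T f g + d_infty T g h"
      using norm_le_d_infty[OF fg t] norm_le_d_infty[OF fg(2) h t] by linarith
  qed
qed

lemma mspace_path_space: "0 \<le> T \<Longrightarrow> mspace (path_space T) = paths T"
  by (simp add: path_space_def Metric_space_paths Metric_space.mspace_metric)

lemma mdist_path_space: "0 \<le> T \<Longrightarrow> mdist (path_space T) = d_infty T"
  by (simp add: path_space_def Metric_space_paths Metric_space.mdist_metric)

definition metric_borel :: "'a metric \<Rightarrow> 'a measure" where
  "metric_borel m = sigma (mspace m) {U. openin (mtopology_of m) U}"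

text \<open>Couplings live on the product sigma-algebra, which for a separable metric space (such as
  \<open>path_space T\<close>) is the Borel sigma-algebra of the product.\<close>

definition couplings :: "'a metric \<Rightarrow> 'a measure \<Rightarrow> 'a measure \<Rightarrow> ('a \<times> 'a) measure set" where
  "couplings m \<mu> \<nu> =
     {\<pi>. prob_space \<pi> \<and> sets \<pi> = sets (metric_borel m \<Otimes>\<^sub>M metric_borel m) \<and>
         distr \<pi> (metric_borel m) fst = \<mu> \<and> distr \<pi> (metric_borel m) snd = \<nu>}"

definition ennreal_root :: "real \<Rightarrow> ennreal \<Rightarrow> ennreal" where
  "ennreal_root p a = (if a = \<top> then \<top> else ennreal (enn2real a powr (1 / p)))"

definition wasserstein :: "real \<Rightarrow> 'a metric \<Rightarrow> 'a measure \<Rightarrow> 'a measure \<Rightarrow> ennreal" where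
  "wasserstein p m \<mu> \<nu> =
     (INF \<pi>\<in>couplings m \<mu> \<nu>. ennreal_root p (\<integral>\<^sup>+(x, y). ennreal (mdist m x y powr p) \<partial>\<pi>))"

text \<open>\<open>KL_divergence (exp 1) \<mu> \<nu>\<close> is the Bochner integral of \<open>ln (d\<nu>/d\<mu>)\<close> against \<open>\<nu>\<close>. It is 0
  by convention if the integrand is not integrable; for probability measures the negative part is
  always integrable, so that in this case the entropy is infinite.\<close>

definition rel_entropy :: "'a measure \<Rightarrow> 'a measure \<Rightarrow> ereal" where
  "rel_entropy \<nu> \<mu> =
     (if absolutely_continuous \<mu> \<nu> \<and> integrable \<nu> (entropy_density (exp 1) \<mu> \<nu>)
      then ereal (KL_divergence (exp 1) \<mu> \<nu>) else \<infinity>)"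

text \<open>If \<open>\<nu>\<close> has infinite entropy, the right-hand side is read as \<open>\<infinity>\<close>, also for \<open>C = 0\<close>
  (the convention \<open>0 * \<infinity> = 0\<close> would make Dirac measures violate \<open>T\<^sub>p(0)\<close>).\<close>

definition transport_ineq :: "real \<Rightarrow> real \<Rightarrow> 'a metric \<Rightarrow> 'a measure \<Rightarrow> bool" where
  "transport_ineq p C m \<mu> \<longleftrightarrow>
     (\<forall>\<nu>. prob_space \<nu> \<and> sets \<nu> = sets (metric_borel m) \<longrightarrow>
        wasserstein p m \<mu> \<nu> \<le>
          (if rel_entropy \<nu> \<mu> = \<infinity> then \<top>
           else ennreal (sqrt (2 * C * real_of_ereal (rel_entropy \<nu> \<mu>)))))"

text \<open>The filtration is indexed by all reals to fit the locale \<open>filtration\<close>; only the times in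
  \<open>[0, T]\<close> matter below, and a filtration on \<open>[0, T]\<close> extends by freezing it at the end points.\<close>

definition complete_filtered_prob_space :: "'w measure \<Rightarrow> (real \<Rightarrow> 'w measure) \<Rightarrow> bool" where
  "complete_filtered_prob_space M F \<longleftrightarrow>
     prob_space M \<and> complete_measure M \<and> filtration (space M) F \<and>
     (\<forall>t. subalgebra M (F t) \<and> null_sets M \<subseteq> sets (F t))"

definition adapted ::
  "(real \<Rightarrow> 'w measure) \<Rightarrow> real \<Rightarrow> (real \<Rightarrow> 'w \<Rightarrow> 'a::euclidean_space) \<Rightarrow> bool" where
  "adapted F T X \<longleftrightarrow> (\<forall>t\<in>{0..T}. X t \<in> borel_measurable (F t))"

text \<open>Constants count as (degenerate) Gaussian variables.\<close>

definition gaussian_rv :: "'w measure \<Rightarrow> ('w \<Rightarrow> real) \<Rightarrow> bool" where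
  "gaussian_rv M Y \<longleftrightarrow>
     (\<exists>m s. 0 < s \<and> distributed M lborel Y (normal_density m s)) \<or>
     (Y \<in> borel_measurable M \<and> (\<exists>m. AE \<omega> in M. Y \<omega> = m))"

definition gaussian_process :: "'w measure \<Rightarrow> 't set \<Rightarrow> ('t \<Rightarrow> 'w \<Rightarrow> real) \<Rightarrow> bool" where
  "gaussian_process M I Y \<longleftrightarrow>
     (\<forall>J c. finite J \<and> J \<subseteq> I \<longrightarrow> gaussian_rv M (\<lambda>\<omega>. \<Sum>t\<in>J. c t * Y t \<omega>))"

definition fbm_cov :: "real \<Rightarrow> real \<Rightarrow> real \<Rightarrow> real" where
  "fbm_cov H s t = (t powr (2 * H) + s powr (2 * H) - \<bar>t - s\<bar> powr (2 * H)) / 2"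

definition fractional_brownian_motion ::
  "'w measure \<Rightarrow> real \<Rightarrow> real \<Rightarrow> (real \<Rightarrow> 'w \<Rightarrow> real ^ 'm::finite) \<Rightarrow> bool" where
  "fractional_brownian_motion M H T B \<longleftrightarrow>
     (\<forall>j. gaussian_process M {0..T} (\<lambda>t \<omega>. B t \<omega> $ j) \<and>
          (\<forall>t\<in>{0..T}. (\<integral>\<omega>. B t \<omega> $ j \<partial>M) = 0) \<and>
          (\<forall>s\<in>{0..T}. \<forall>t\<in>{0..T}. (\<integral>\<omega>. B s \<omega> $ j * B t \<omega> $ j \<partial>M) = fbm_cov H s t)) \<and>
     prob_space.indep_vars M (\<lambda>j. \<Pi>\<^sub>M t\<in>{0..T}. borel) (\<lambda>j \<omega>. \<lambda>t\<in>{0..T}. B t \<omega> $ j) UNIV"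

text \<open>Convergence of the Riemann--Stieltjes sums as the mesh of the tagged division tends to 0.
  The members \<open>K\<close> of a tagged division of \<open>{a..b}\<close> are the intervals \<open>{Inf K..Sup K}\<close>.\<close>

definition has_RS_integral ::
  "(real \<Rightarrow> real) \<Rightarrow> (real \<Rightarrow> real) \<Rightarrow> real \<Rightarrow> real \<Rightarrow> real \<Rightarrow> bool" where
  "has_RS_integral f g a b I \<longleftrightarrow>
     (\<forall>e>0. \<exists>\<delta>>0. \<forall>D. D tagged_division_of {a..b} \<and> (\<forall>(\<xi>, K)\<in>D. diameter K < \<delta>) \<longrightarrow>
        \<bar>(\<Sum>(\<xi>, K)\<in>D. f \<xi> * (g (Sup K) - g (Inf K))) - I\<bar> < e)"

definition sde_solution ::
  "'w measure \<Rightarrow> (real \<Rightarrow> 'w measure) \<Rightarrow> real \<Rightarrow> real ^ 'd \<Rightarrow> (real ^ 'd \<Rightarrow> real ^ 'd) \<Rightarrow>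
   (real \<Rightarrow> real ^ 'm ^ 'd) \<Rightarrow> (real \<Rightarrow> 'w \<Rightarrow> real ^ 'm::finite) \<Rightarrow>
   (real \<Rightarrow> 'w \<Rightarrow> real ^ 'd::finite) \<Rightarrow> bool" where
  "sde_solution M F T x b \<sigma> B X \<longleftrightarrow>
     adapted F T X \<and>
     (\<forall>\<omega>\<in>space M. continuous_on {0..T} (\<lambda>t. X t \<omega>)) \<and>
     (AE \<omega> in M. \<forall>t\<in>{0..T}. \<forall>i. \<exists>I.
        (\<forall>j. has_RS_integral (\<lambda>s. \<sigma> s $ i $ j) (\<lambda>s. B s \<omega> $ j) 0 t (I j)) \<and>
        X t \<omega> $ i = x $ i + integral {0..t} (\<lambda>s. b (X s \<omega>) $ i) + (\<Sum>j\<in>UNIV. I j))"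

definition path_law ::
  "'w measure \<Rightarrow> real \<Rightarrow> (real \<Rightarrow> 'w \<Rightarrow> 'a::euclidean_space) \<Rightarrow> (real \<Rightarrow> 'a) measure" where
  "path_law M T X = distr M (metric_borel (path_space T)) (\<lambda>\<omega>. \<lambda>t\<in>{0..T}. X t \<omega>)"

end

theory Submission
  imports Defs
begin

text \<open>
  The noise \<open>Z\<^sub>t = x + \<integral>\<^sub>0\<^sup>t \<sigma> dB\<close> determines the solution path through a map that is Lipschitz for
  the supremum norm: two solutions satisfy
  \<open>d\<^sub>\<infinity>(X, X') \<le> sup \<bar>Z - Z'\<bar> + L\<^sub>b T d\<^sub>\<infinity>(X, X')\<close>, and \<open>L\<^sub>b T \<le> 1/2\<close>, so that
  \<open>d\<^sub>\<infinity>(X, X') \<le> 2 sup \<bar>Z - Z'\<bar>\<close> (\<open>solution_map_lipschitz\<close>). The noise is a Gaussian object of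
  size \<open>A = \<parallel>\<sigma>\<parallel> T\<^sup>H\<close>. Hence the law of \<open>X\<close> has Gaussian concentration at scale \<open>A\<close>, and this is
  what \<open>T\<^sub>1\<close> with a constant of order \<open>A\<^sup>2\<close> expresses. Three arguments make this precise.

  \<^item> \<^emph>\<open>Transport.\<close> If \<open>\<integral> exp (\<alpha> d(x\<^sub>0, \<cdot>)\<^sup>2) d\<mu> \<le> C\<close> for some point \<open>x\<^sub>0\<close>, then \<open>\<mu>\<close> satisfies
    \<open>T\<^sub>1((3/2 + C)\<^sup>2 / (2\<alpha>))\<close> (\<open>transport_ineq_of_exp_moment\<close>). The coupling of \<open>\<mu>\<close> and
    \<open>\<nu> = u \<mu>\<close> that leaves the common mass \<open>min 1 u\<close> in place and joins the two remainders
    independently costs at most \<open>\<integral> d(x\<^sub>0, \<cdot>) \<bar>u - 1\<bar> d\<mu>\<close>; a weighted form of Pinsker's inequality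
    in the style of Bolley and Villani (\<open>weighted_pinsker\<close>) bounds this by the square root of the
    entropy.

  \<^item> \<^emph>\<open>Gaussian estimate.\<close> For \<open>H \<ge> 1/2\<close> the increments of fractional Brownian motion over the cells
    of a grid are nonnegatively correlated, because \<open>\<bar>\<cdot>\<bar>\<^sup>2\<^sup>H\<close> is convex. So the second moment of a
    Riemann sum of \<open>\<integral> f dB\<close> over an interval of length \<open>h\<close> is largest, among all \<open>\<bar>f\<bar> \<le> L\<close>, for the
    constant \<open>f = L\<close>, where it is \<open>L\<^sup>2 h\<^sup>2\<^sup>H\<close> (\<open>riemann_sum_second_moment\<close>). Here \<open>L\<close>
    may be taken as the Hoelder norm of \<open>\<sigma>\<close>, which dominates its supremum. For \<open>h = T / 2\<^sup>n\<close> this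
    is at most \<open>A\<^sup>2 / 2\<^sup>n\<close>, uniformly in \<open>H\<close>, and Fatou's lemma carries the square-exponential moments of the Riemann sums
    over to the integrals (\<open>increment_exp_moment_integral\<close>).

  \<^item> \<^emph>\<open>Chaining.\<close> A path is controlled by its dyadic increments, so \<open>sup \<bar>Z - x\<bar>\<^sup>2\<close> is at most a
    constant times \<open>A\<^sup>2 (1 + ln Y)\<close> with an integrable \<open>Y \<ge> 1\<close> (\<open>sde_exponential_bound\<close>).

  As \<open>x\<^sub>0\<close> serves the solution path at one outcome \<open>\<omega>\<^sub>0\<close> whose noise is not exceptionally large.
  The resulting factor in front of \<open>A\<^sup>2\<close> depends on the dimensions \<open>d\<close> and \<open>m\<close> alone
  (\<open>transport_const\<close>).
\<close>

section \<open>Pointwise inequalities for the relative entropy\<close>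

text \<open>With \<open>s = \<surd>u\<close>, the inequality \<open>ln s \<ge> 1 - 1/s\<close> gives \<open>u ln u - u + 1 \<ge> (s - 1)\<^sup>2\<close>, while
  \<open>(u - 1)\<^sup>2 = (s - 1)\<^sup>2 (s + 1)\<^sup>2\<close> and \<open>(s + 1)\<^sup>2 \<le> 2 (1 + u)\<close>.\<close>
lemma entropy_integrand_nonneg_bound:
  fixes u :: real assumes "0 \<le> u"
  shows "(u - 1)\<^sup>2 \<le> 2 * (1 + u) * (u * ln u - u + 1)"
proof (cases "u = 0")
  case False
  define s where "s = sqrt u"
  have s: "s > 0" "u = s^2" using assms False by (auto simp: s_def)
  have "ln s \<ge> 1 - 1 / s"
    using ln_le_minus_one[of "1 / s"] s(1) by (simp add: ln_div)
  then have "s * ln s \<ge> s - 1" using s(1) by (simp add: field_simps)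
  then have "2 * (s * (s * ln s)) \<ge> 2 * (s * (s - 1))" using s(1) by simp
  then have h: "u * ln u - u + 1 \<ge> (s - 1)^2"
    using s by (simp add: ln_mult power2_eq_square algebra_simps)
  have "(s + 1)\<^sup>2 \<le> 2 * (1 + u)" using s sum_squares_bound[of s 1] by (simp add: power2_eq_square algebra_simps)
  then have "(s + 1)\<^sup>2 * (s - 1)\<^sup>2 \<le> 2 * (1 + u) * (u * ln u - u + 1)"
    using h assms by (intro mult_mono) auto
  then show ?thesis unfolding s(2) by (simp add: power2_eq_square algebra_simps)
qed simp

text \<open>Young's inequality for the convex function \<open>u ln u - u\<close>, whose conjugate is the exponential.\<close>
lemma entropy_young:
  fixes u v :: real assumes "0 \<le> u"
  shows "u * v \<le> (u * ln u - u + 1) + exp v"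
proof (cases "u = 0")
  case False
  then have u: "u > 0" using assms by simp
  have "exp (v - ln u) \<ge> 1 + (v - ln u)" by (rule exp_ge_add_one_self)
  then have "u * exp (v - ln u) \<ge> u * (1 + (v - ln u))" using u by simp
  moreover have "u * exp (v - ln u) = exp v" using u by (simp add: exp_diff)
  ultimately show ?thesis by (simp add: algebra_simps)
qed (use exp_gt_zero[of v] in simp)

lemma entropy_integrand_nonneg:
  fixes u :: real assumes "0 \<le> u"
  shows "0 \<le> u * ln u - u + 1"
proof -
  have "0 \<le> 2 * (1 + u) * (u * ln u - u + 1)"
    using entropy_integrand_nonneg_bound[OF assms] zero_le_power2 order_trans by blast
  then show ?thesis using assms by (simp add: zero_le_mult_iff)
qed

text \<open>The two bounds on \<open>\<phi> \<bar>u - 1\<bar>\<close> below are linear in the entropy integrand \<open>h\<close> and in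
  \<open>exp (\<alpha> \<phi>\<^sup>2)\<close>, up to a free parameter, so that they can be integrated and the parameter optimised
  afterwards. This one is sharp for small entropy: it combines
  \<open>(u - 1)\<^sup>2 \<le> 2 (1 + u) h\<close> with the arithmetic-geometric mean inequality and then
  removes \<open>u \<phi>\<^sup>2\<close> by Young's inequality.\<close>
lemma weighted_deviation_small:
  fixes u \<phi> \<alpha> l :: real
  assumes "0 \<le> u" "0 \<le> \<phi>" "0 < \<alpha>" "0 < l"
  defines "h \<equiv> u * ln u - u + 1"
  shows "\<phi> * \<bar>u - 1\<bar> \<le> h / l + l * (h + 2 * exp (\<alpha> * \<phi>\<^sup>2)) / (2 * \<alpha>)"
proof -
  have h0: "0 \<le> h" unfolding h_def by (rule entropy_integrand_nonneg) fact
  have 1: "\<alpha> * ((1 + u) * \<phi>\<^sup>2) \<le> h + 2 * exp (\<alpha> * \<phi>\<^sup>2)"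
  proof -
    have "\<alpha> * \<phi>\<^sup>2 \<le> exp (\<alpha> * \<phi>\<^sup>2)"
      using exp_ge_add_one_self[of "\<alpha> * \<phi>\<^sup>2"] by linarith
    then show ?thesis
      using entropy_young[OF assms(1), of "\<alpha> * \<phi>\<^sup>2"] by (simp add: h_def algebra_simps)
  qed
  define w where "w = (1 + u) * \<phi>\<^sup>2"
  have "(\<phi> * \<bar>u - 1\<bar>)\<^sup>2 \<le> \<phi>\<^sup>2 * (2 * (1 + u) * h)"
    using mult_left_mono[OF entropy_integrand_nonneg_bound[OF assms(1)], of "\<phi>\<^sup>2"]
    by (simp add: power_mult_distrib h_def)
  also have "\<dots> = 4 * (h / l) * (l * w / 2)" using assms by (simp add: w_def field_simps)
  also have "\<dots> \<le> (h / l + l * w / 2)\<^sup>2"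
  proof -
    have "4 * a * c \<le> (a + c)\<^sup>2" for a c :: real
      using sum_squares_bound[of a c] by (simp add: power2_sum)
    then show ?thesis .
  qed
  finally have "\<phi> * \<bar>u - 1\<bar> \<le> h / l + l * w / 2"
    using h0 assms by (elim power2_le_imp_le) (auto simp: w_def)
  moreover have "w \<le> (h + 2 * exp (\<alpha> * \<phi>\<^sup>2)) / \<alpha>" using 1 assms by (simp add: w_def field_simps)
  then have "l * w / 2 \<le> l * ((h + 2 * exp (\<alpha> * \<phi>\<^sup>2)) / \<alpha>) / 2" using assms by (intro divide_right_mono mult_left_mono) auto
  moreover have "l * ((h + 2 * exp (\<alpha> * \<phi>\<^sup>2)) / \<alpha>) / 2 = l * (h + 2 * exp (\<alpha> * \<phi>\<^sup>2)) / (2 * \<alpha>)" by simp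
  ultimately show ?thesis by linarith
qed

text \<open>For large entropy the cruder \<open>\<bar>u - 1\<bar> \<le> 1 + u\<close> is enough, and it keeps the growth in
  the entropy to a square root.\<close>
lemma weighted_deviation_large:
  fixes u \<phi> \<alpha> s :: real
  assumes "0 \<le> u" "0 \<le> \<phi>" "0 < \<alpha>" "0 < s"
  defines "h \<equiv> u * ln u - u + 1"
  shows "\<phi> * \<bar>u - 1\<bar> \<le> s * (1 + u) / 2 + (h + 2 * exp (\<alpha> * \<phi>\<^sup>2)) / (2 * \<alpha> * s)"
proof -
  have 1: "\<alpha> * ((1 + u) * \<phi>\<^sup>2) \<le> h + 2 * exp (\<alpha> * \<phi>\<^sup>2)"
  proof -
    have "\<alpha> * \<phi>\<^sup>2 \<le> exp (\<alpha> * \<phi>\<^sup>2)"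
      using exp_ge_add_one_self[of "\<alpha> * \<phi>\<^sup>2"] by linarith
    then show ?thesis
      using entropy_young[OF assms(1), of "\<alpha> * \<phi>\<^sup>2"] by (simp add: h_def algebra_simps)
  qed
  have "\<phi> \<le> (s + \<phi>\<^sup>2 / s) / 2"
    using sum_squares_bound[of s \<phi>] assms by (simp add: field_simps power2_eq_square)
  then have "\<phi> * (1 + u) \<le> (s + \<phi>\<^sup>2 / s) / 2 * (1 + u)" using assms by (intro mult_right_mono) auto
  also have "\<dots> = s * (1 + u) / 2 + (\<alpha> * ((1 + u) * \<phi>\<^sup>2)) / (2 * \<alpha> * s)"
    using assms by (simp add: field_simps)
  also have "\<dots> \<le> s * (1 + u) / 2 + (h + 2 * exp (\<alpha> * \<phi>\<^sup>2)) / (2 * \<alpha> * s)"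
    using 1 assms by (intro add_left_mono divide_right_mono) auto
  finally show ?thesis using assms mult_left_mono[of "\<bar>u - 1\<bar>" "1 + u" \<phi>] by linarith
qed

section \<open>The overlap coupling\<close>

lemma sets_metric_borel: "sets (metric_borel m) = sigma_sets (mspace m) {U. openin (mtopology_of m) U}"
  unfolding metric_borel_def by (rule sets_measure_of) (auto dest!: openin_subset simp: topspace_mtopology_of)

lemma space_metric_borel [simp]: "space (metric_borel m) = mspace m"
  unfolding metric_borel_def by (rule space_measure_of) (auto dest!: openin_subset simp: topspace_mtopology_of)

text \<open>With probability \<open>min 1 (f x)\<close> the point \<open>x\<close>, drawn from \<open>\<mu>\<close>, stays where it is (Boolean
  coordinate \<open>True\<close>); the deficit \<open>(1 - f)\<^sup>+ \<mu>\<close> is joined independently to the excess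
  \<open>(f - 1)\<^sup>+ \<mu>\<close>. Encoding the choice as a Boolean coordinate makes the coupling one image of one
  density. The subtraction on extended nonnegative reals truncates, so it is the positive part.\<close>
definition overlap_coupling :: "'a measure \<Rightarrow> ('a \<Rightarrow> ennreal) \<Rightarrow> ('a \<times> 'a) measure" where
  "overlap_coupling \<mu> f =
     distr (density ((\<mu> \<Otimes>\<^sub>M \<mu>) \<Otimes>\<^sub>M count_space (UNIV :: bool set))
         (\<lambda>((x, y), c). if c then min 1 (f x)
            else (1 - f x) * (f y - 1) / (\<integral>\<^sup>+z. (1 - f z) \<partial>\<mu>)))
       (\<mu> \<Otimes>\<^sub>M \<mu>) (\<lambda>((x, y), c). if c then (x, x) else (x, y))"

lemma sets_overlap_coupling [simp]: "sets (overlap_coupling \<mu> f) = sets (\<mu> \<Otimes>\<^sub>M \<mu>)"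
  by (simp add: overlap_coupling_def)

lemma nn_integral_overlap_coupling:
  assumes "prob_space \<mu>" and [measurable]: "f \<in> borel_measurable \<mu>" "F \<in> borel_measurable (\<mu> \<Otimes>\<^sub>M \<mu>)"
  shows "(\<integral>\<^sup>+z. F z \<partial>overlap_coupling \<mu> f) =
    (\<integral>\<^sup>+x. min 1 (f x) * F (x, x) \<partial>\<mu>) +
    (\<integral>\<^sup>+x. \<integral>\<^sup>+y. (1 - f x) * (f y - 1) / (\<integral>\<^sup>+z. (1 - f z) \<partial>\<mu>) * F (x, y) \<partial>\<mu> \<partial>\<mu>)"
proof -
  interpret prob_space \<mu> by fact
  interpret C: sigma_finite_measure "count_space (UNIV :: bool set)"
    by (rule sigma_finite_measure_count_space_finite) simp
  have [measurable]: "(\<lambda>((x, y), c). if c then (x, x) else (x, y))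
      \<in> (\<mu> \<Otimes>\<^sub>M \<mu>) \<Otimes>\<^sub>M count_space (UNIV :: bool set) \<rightarrow>\<^sub>M \<mu> \<Otimes>\<^sub>M \<mu>"
    unfolding split_beta' by measurable
  have [measurable]: "(\<lambda>((x, y), c). if c then min 1 (f x)
            else (1 - f x) * (f y - 1) / (\<integral>\<^sup>+z. (1 - f z) \<partial>\<mu>))
      \<in> borel_measurable ((\<mu> \<Otimes>\<^sub>M \<mu>) \<Otimes>\<^sub>M count_space (UNIV :: bool set))"
    unfolding split_beta' by measurable
  have "(\<integral>\<^sup>+z. F z \<partial>overlap_coupling \<mu> f) =
    (\<integral>\<^sup>+z. (case z of ((x, y), c) \<Rightarrow> if c then min 1 (f x)
            else (1 - f x) * (f y - 1) / (\<integral>\<^sup>+z. (1 - f z) \<partial>\<mu>)) *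
         F (case z of ((x, y), c) \<Rightarrow> if c then (x, x) else (x, y))
       \<partial>((\<mu> \<Otimes>\<^sub>M \<mu>) \<Otimes>\<^sub>M count_space (UNIV :: bool set)))"
    unfolding overlap_coupling_def
    by (simp add: nn_integral_distr nn_integral_density split_beta')
  also have "\<dots> = (\<integral>\<^sup>+z. (min 1 (f (fst z)) * F (fst z, fst z) +
       (1 - f (fst z)) * (f (snd z) - 1) / (\<integral>\<^sup>+z. (1 - f z) \<partial>\<mu>) * F z) \<partial>(\<mu> \<Otimes>\<^sub>M \<mu>))"
    by (subst C.nn_integral_fst[symmetric], measurable)
       (simp add: nn_integral_count_space_finite UNIV_bool split_beta add.commute)
  also have "\<dots> = (\<integral>\<^sup>+z. min 1 (f (fst z)) * F (fst z, fst z) \<partial>(\<mu> \<Otimes>\<^sub>M \<mu>)) +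
       (\<integral>\<^sup>+z. (1 - f (fst z)) * (f (snd z) - 1) / (\<integral>\<^sup>+z. (1 - f z) \<partial>\<mu>) * F z \<partial>(\<mu> \<Otimes>\<^sub>M \<mu>))"
    by (intro nn_integral_add; measurable)
  finally show ?thesis
    by (subst (asm) (1 2) nn_integral_fst[symmetric]) (measurable, simp add: emeasure_space_1)
qed


lemma overlap_plus_deficit: "min 1 u + (1 - u) = (1 :: ennreal)"
  by (cases "u \<le> 1") (auto simp: min_def diff_eq_0_iff_ennreal add_diff_inverse_ennreal not_le order_le_less_trans)

lemma overlap_plus_excess: "min 1 u + (u - 1) = (u :: ennreal)"
  by (cases "u \<le> 1") (auto simp: min_def diff_eq_0_iff_ennreal add_diff_inverse_ennreal not_le order_le_less_trans)

text \<open>The deficit and the excess have the same mass, so each marginal of their normalised product is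
  one of the two factors.\<close>
lemma deficit_product_integrals:
  assumes \<mu>: "prob_space \<mu>" and [measurable]: "f \<in> borel_measurable \<mu>" "G \<in> borel_measurable \<mu>"
    and f: "(\<integral>\<^sup>+x. f x \<partial>\<mu>) = 1"
  defines "a \<equiv> \<integral>\<^sup>+x. (1 - f x) \<partial>\<mu>"
  shows "(\<integral>\<^sup>+x. \<integral>\<^sup>+y. (1 - f x) * (f y - 1) / a * G x \<partial>\<mu> \<partial>\<mu>) = (\<integral>\<^sup>+x. (1 - f x) * G x \<partial>\<mu>)"
    and "(\<integral>\<^sup>+x. \<integral>\<^sup>+y. (1 - f x) * (f y - 1) / a * G y \<partial>\<mu> \<partial>\<mu>) = (\<integral>\<^sup>+x. (f x - 1) * G x \<partial>\<mu>)"
proof -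
  interpret prob_space \<mu> by fact
  have 1: "(\<integral>\<^sup>+x. min 1 (f x) \<partial>\<mu>) + a = 1"
    unfolding a_def by (subst nn_integral_add[symmetric]) (auto simp: overlap_plus_deficit emeasure_space_1)
  have 2: "(\<integral>\<^sup>+x. min 1 (f x) \<partial>\<mu>) + (\<integral>\<^sup>+x. (f x - 1) \<partial>\<mu>) = 1"
    by (subst nn_integral_add[symmetric]) (auto simp: overlap_plus_excess f)
  have fin: "a \<noteq> \<top>" "(\<integral>\<^sup>+x. min 1 (f x) \<partial>\<mu>) \<noteq> \<top>" using 1 by auto
  have ab: "(\<integral>\<^sup>+x. (f x - 1) \<partial>\<mu>) = a"
  proof -
    have "(\<integral>\<^sup>+x. min 1 (f x) \<partial>\<mu>) + (\<integral>\<^sup>+x. (f x - 1) \<partial>\<mu>) = (\<integral>\<^sup>+x. min 1 (f x) \<partial>\<mu>) + a"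
      using 1 2 by simp
    then show ?thesis using fin by (auto simp: ennreal_add_left_cancel)
  qed
  \<comment> \<open>If the deficit has mass 0, then \<open>a / a = 0\<close>, but the deficit vanishes almost everywhere.\<close>
  have c1: "AE x in \<mu>. (1 - f x) * (a / a) = 1 - f x"
  proof (cases "a = 0")
    case True
    then have "AE x in \<mu>. 1 - f x = 0" unfolding a_def by (subst (asm) nn_integral_0_iff_AE) auto
    then show ?thesis by eventually_elim simp
  qed (use fin in \<open>simp add: less_top\<close>)
  have c2: "AE x in \<mu>. (f x - 1) * (a / a) = f x - 1"
  proof (cases "a = 0")
    case True
    then have "AE x in \<mu>. f x - 1 = 0" unfolding ab[symmetric] by (subst (asm) nn_integral_0_iff_AE) auto
    then show ?thesis by eventually_elim simp
  qed (use fin in \<open>simp add: less_top\<close>)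
  have "(\<integral>\<^sup>+x. \<integral>\<^sup>+y. (1 - f x) * (f y - 1) / a * G x \<partial>\<mu> \<partial>\<mu>) =
      (\<integral>\<^sup>+x. \<integral>\<^sup>+y. (1 - f x) * G x / a * (f y - 1) \<partial>\<mu> \<partial>\<mu>)"
    by (simp add: divide_ennreal_def ac_simps)
  also have "\<dots> = (\<integral>\<^sup>+x. ((1 - f x) * (a / a)) * G x \<partial>\<mu>)"
    by (simp add: nn_integral_cmult ab divide_ennreal_def ac_simps)
  also have "\<dots> = (\<integral>\<^sup>+x. (1 - f x) * G x \<partial>\<mu>)"
    using c1 by (intro nn_integral_cong_AE) auto
  finally show "(\<integral>\<^sup>+x. \<integral>\<^sup>+y. (1 - f x) * (f y - 1) / a * G x \<partial>\<mu> \<partial>\<mu>) = (\<integral>\<^sup>+x. (1 - f x) * G x \<partial>\<mu>)" .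
  have "(\<integral>\<^sup>+x. \<integral>\<^sup>+y. (1 - f x) * (f y - 1) / a * G y \<partial>\<mu> \<partial>\<mu>) =
      (\<integral>\<^sup>+x. \<integral>\<^sup>+y. (1 - f x) / a * ((f y - 1) * G y) \<partial>\<mu> \<partial>\<mu>)"
    by (simp add: divide_ennreal_def ac_simps)
  also have "\<dots> = a / a * (\<integral>\<^sup>+y. (f y - 1) * G y \<partial>\<mu>)"
    by (simp add: nn_integral_cmult nn_integral_multc nn_integral_divide a_def[symmetric])
  also have "\<dots> = (\<integral>\<^sup>+x. ((f x - 1) * (a / a)) * G x \<partial>\<mu>)"
    by (subst nn_integral_cmult[symmetric]) (auto simp: ac_simps)
  also have "\<dots> = (\<integral>\<^sup>+x. (f x - 1) * G x \<partial>\<mu>)"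
    using c2 by (intro nn_integral_cong_AE) auto
  finally show "(\<integral>\<^sup>+x. \<integral>\<^sup>+y. (1 - f x) * (f y - 1) / a * G y \<partial>\<mu> \<partial>\<mu>) = (\<integral>\<^sup>+x. (f x - 1) * G x \<partial>\<mu>)" .
qed

lemma overlap_coupling_marginals:
  assumes \<mu>: "prob_space \<mu>" and [measurable]: "f \<in> borel_measurable \<mu>"
    and f: "(\<integral>\<^sup>+x. f x \<partial>\<mu>) = 1"
  shows "distr (overlap_coupling \<mu> f) \<mu> fst = \<mu>"
    and "distr (overlap_coupling \<mu> f) \<mu> snd = density \<mu> f"
proof -
  have mm: "fst \<in> overlap_coupling \<mu> f \<rightarrow>\<^sub>M \<mu>" "snd \<in> overlap_coupling \<mu> f \<rightarrow>\<^sub>M \<mu>"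
    by (simp_all cong: measurable_cong_sets)
  show "distr (overlap_coupling \<mu> f) \<mu> fst = \<mu>"
  proof (rule measure_eqI)
    fix A assume "A \<in> sets (distr (overlap_coupling \<mu> f) \<mu> fst)"
    then have [measurable]: "A \<in> sets \<mu>" by simp
    have "emeasure (distr (overlap_coupling \<mu> f) \<mu> fst) A =
       (\<integral>\<^sup>+z. indicator A (fst z) \<partial>overlap_coupling \<mu> f)"
      using mm by (subst nn_integral_distr[of fst _ \<mu> "indicator A", symmetric]) auto
    also have "\<dots> = (\<integral>\<^sup>+x. min 1 (f x) * indicator A x \<partial>\<mu>) + (\<integral>\<^sup>+x. (1 - f x) * indicator A x \<partial>\<mu>)"
      using \<mu> f by (subst nn_integral_overlap_coupling) (auto simp: deficit_product_integrals)
    also have "\<dots> = (\<integral>\<^sup>+x. indicator A x \<partial>\<mu>)"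
      by (subst nn_integral_add[symmetric]) (auto simp: overlap_plus_deficit distrib_right[symmetric])
    finally show "emeasure (distr (overlap_coupling \<mu> f) \<mu> fst) A = emeasure \<mu> A" by simp
  qed simp
  show "distr (overlap_coupling \<mu> f) \<mu> snd = density \<mu> f"
  proof (rule measure_eqI)
    fix A assume "A \<in> sets (distr (overlap_coupling \<mu> f) \<mu> snd)"
    then have [measurable]: "A \<in> sets \<mu>" by simp
    have "emeasure (distr (overlap_coupling \<mu> f) \<mu> snd) A =
       (\<integral>\<^sup>+z. indicator A (snd z) \<partial>overlap_coupling \<mu> f)"
      using mm by (subst nn_integral_distr[of snd _ \<mu> "indicator A", symmetric]) auto
    also have "\<dots> = (\<integral>\<^sup>+x. min 1 (f x) * indicator A x \<partial>\<mu>) + (\<integral>\<^sup>+x. (f x - 1) * indicator A x \<partial>\<mu>)"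
      using \<mu> f by (subst nn_integral_overlap_coupling) (auto simp: deficit_product_integrals)
    also have "\<dots> = (\<integral>\<^sup>+x. f x * indicator A x \<partial>\<mu>)"
      by (subst nn_integral_add[symmetric]) (auto simp: overlap_plus_excess distrib_right[symmetric])
    finally show "emeasure (distr (overlap_coupling \<mu> f) \<mu> snd) A = emeasure (density \<mu> f) A"
      by (simp add: emeasure_density)
  qed simp
qed

lemma overlap_coupling_in_couplings:
  assumes \<mu>: "prob_space \<mu>" and s: "sets \<mu> = sets (metric_borel m)" and [measurable]: "f \<in> borel_measurable \<mu>"
    and f: "(\<integral>\<^sup>+x. f x \<partial>\<mu>) = 1"
  shows "overlap_coupling \<mu> f \<in> couplings m \<mu> (density \<mu> f)"
proof -
  interpret prob_space \<mu> by fact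
  note marg = overlap_coupling_marginals[OF \<mu> _ f]
  have "emeasure (distr (overlap_coupling \<mu> f) \<mu> fst) (space \<mu>) = 1"
    by (simp add: marg emeasure_space_1)
  moreover have "fst \<in> overlap_coupling \<mu> f \<rightarrow>\<^sub>M \<mu>"
    by (simp cong: measurable_cong_sets)
  moreover have "fst -` space \<mu> \<inter> space (overlap_coupling \<mu> f) = space (overlap_coupling \<mu> f)"
    using sets_eq_imp_space_eq[OF sets_overlap_coupling, of \<mu> f] by (auto simp: space_pair_measure)
  ultimately have "emeasure (overlap_coupling \<mu> f) (space (overlap_coupling \<mu> f)) = 1"
    by (simp add: emeasure_distr)
  moreover have "distr (overlap_coupling \<mu> f) (metric_borel m) g = distr (overlap_coupling \<mu> f) \<mu> g" for g
    using s by (intro distr_cong) auto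
  ultimately show ?thesis
    unfolding couplings_def by (simp add: marg prob_spaceI sets_pair_measure_cong[OF s s])
qed

text \<open>The part that stays in place costs nothing; in the other part the triangle inequality through
  \<open>x\<^sub>0\<close> splits the distance into one term for each marginal.\<close>
lemma overlap_coupling_cost:
  assumes \<mu>: "prob_space \<mu>" and s: "sets \<mu> = sets (metric_borel m)" and fm: "f \<in> borel_measurable \<mu>"
    and f: "(\<integral>\<^sup>+x. f x \<partial>\<mu>) = 1" and x0: "x0 \<in> mspace m"
    and d: "(\<lambda>(x, y). mdist m x y) \<in> borel_measurable (metric_borel m \<Otimes>\<^sub>M metric_borel m)"
  shows "(\<integral>\<^sup>+(x, y). ennreal (mdist m x y) \<partial>overlap_coupling \<mu> f) \<le>
    (\<integral>\<^sup>+x. ((1 - f x) + (f x - 1)) * ennreal (mdist m x0 x) \<partial>\<mu>)"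
proof -
  note [measurable] = fm
  interpret prob_space \<mu> by fact
  interpret Metric_space "mspace m" "mdist m" by simp
  have sp: "space \<mu> = mspace m" using sets_eq_imp_space_eq[OF s] by simp
  define D where "D = (\<lambda>(x, y). ennreal (mdist m x y))"
  have D[measurable]: "D \<in> borel_measurable (\<mu> \<Otimes>\<^sub>M \<mu>)"
    using d s measurable_compose[OF d, of ennreal borel] unfolding D_def
    by (simp add: split_beta' cong: measurable_cong_sets sets_pair_measure_cong)
  have x0': "x0 \<in> space \<mu>" using x0 sp by simp
  have mx0[measurable]: "(\<lambda>x. ennreal (mdist m x0 x)) \<in> borel_measurable \<mu>"
    using measurable_compose[OF measurable_Pair1'[OF x0', of \<mu>] D] by (simp add: D_def)
  let ?a = "\<integral>\<^sup>+x. (1 - f x) \<partial>\<mu>"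
  have "(\<integral>\<^sup>+z. D z \<partial>overlap_coupling \<mu> f) =
     (\<integral>\<^sup>+x. min 1 (f x) * D (x, x) \<partial>\<mu>) +
     (\<integral>\<^sup>+x. \<integral>\<^sup>+y. (1 - f x) * (f y - 1) / ?a * D (x, y) \<partial>\<mu> \<partial>\<mu>)"
    using \<mu> by (intro nn_integral_overlap_coupling) auto
  also have "(\<integral>\<^sup>+x. min 1 (f x) * D (x, x) \<partial>\<mu>) = (\<integral>\<^sup>+x. 0 \<partial>\<mu>)"
    by (intro nn_integral_cong) (auto simp: D_def sp)
  also have "(\<integral>\<^sup>+x. 0 \<partial>\<mu>) + (\<integral>\<^sup>+x. \<integral>\<^sup>+y. (1 - f x) * (f y - 1) / ?a * D (x, y) \<partial>\<mu> \<partial>\<mu>) \<le>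
     (\<integral>\<^sup>+x. \<integral>\<^sup>+y. (1 - f x) * (f y - 1) / ?a * mdist m x0 x + (1 - f x) * (f y - 1) / ?a * mdist m x0 y \<partial>\<mu> \<partial>\<mu>)"
    unfolding distrib_left[symmetric] nn_integral_const mult_zero_left add_0
  proof (intro nn_integral_mono mult_left_mono)
    fix x y assume "x \<in> space \<mu>" "y \<in> space \<mu>"
    then have "mdist m x y \<le> mdist m x0 x + mdist m x0 y"
      using triangle[of x x0 y] x0 sp commute[of x x0] by simp
    then show "D (x, y) \<le> ennreal (mdist m x0 x) + ennreal (mdist m x0 y)"
      by (simp add: D_def flip: ennreal_plus)
  qed simp
  also have "\<dots> = (\<integral>\<^sup>+x. (1 - f x) * mdist m x0 x \<partial>\<mu>) + (\<integral>\<^sup>+x. (f x - 1) * mdist m x0 x \<partial>\<mu>)"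
    using deficit_product_integrals[OF \<mu> fm mx0 f]
    by (simp add: nn_integral_add)
  also have "\<dots> = (\<integral>\<^sup>+x. ((1 - f x) + (f x - 1)) * mdist m x0 x \<partial>\<mu>)"
    by (simp add: nn_integral_add distrib_right)
  finally show ?thesis by (simp add: D_def)
qed


section \<open>From a square-exponential moment to \<open>T\<^sub>1\<close>\<close>

text \<open>Since \<open>u\<close> has integral 1, adding \<open>1 - u\<close> to \<open>u ln u\<close> leaves the entropy unchanged and makes
  the integrand nonnegative, which allows pointwise estimates.\<close>
lemma entropy_as_integral:
  assumes \<mu>: "prob_space \<mu>" and \<nu>: "prob_space \<nu>" and s: "sets \<nu> = sets \<mu>"
    and fin: "rel_entropy \<nu> \<mu> \<noteq> \<infinity>"
  obtains u where "u \<in> borel_measurable \<mu>" "\<And>x. 0 \<le> u x" "density \<mu> (\<lambda>x. ennreal (u x)) = \<nu>"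
    "(\<integral>\<^sup>+x. ennreal (u x) \<partial>\<mu>) = 1"
    "(\<integral>\<^sup>+x. ennreal (u x * ln (u x) - u x + 1) \<partial>\<mu>) = ennreal (real_of_ereal (rel_entropy \<nu> \<mu>))"
    "0 \<le> real_of_ereal (rel_entropy \<nu> \<mu>)"
proof -
  interpret prob_space \<mu> by fact
  interpret N: prob_space \<nu> by fact
  have ac: "absolutely_continuous \<mu> \<nu>" and int: "integrable \<nu> (entropy_density (exp 1) \<mu> \<nu>)"
    using fin by (auto simp: rel_entropy_def split: if_splits)
  have KL: "real_of_ereal (rel_entropy \<nu> \<mu>) = KL_divergence (exp 1) \<mu> \<nu>"
    using ac int by (simp add: rel_entropy_def)
  define u where "u x = enn2real (RN_deriv \<mu> \<nu> x)" for x
  have [measurable]: "u \<in> borel_measurable \<mu>" unfolding u_def by measurable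
  have u0: "0 \<le> u x" for x by (simp add: u_def)
  have "AE x in \<mu>. RN_deriv \<mu> \<nu> x = ennreal (u x)"
    using RN_deriv_finite[OF _ ac s] N.sigma_finite_measure_axioms
    by (auto simp: u_def less_top elim!: eventually_mono)
  then have d: "density \<mu> (\<lambda>x. ennreal (u x)) = \<nu>"
    using density_RN_deriv[OF ac s] by (subst (asm) density_cong) auto
  have u1: "(\<integral>\<^sup>+x. ennreal (u x) \<partial>\<mu>) = 1"
    using N.emeasure_space_1 unfolding d[symmetric] by (simp add: emeasure_density cong: nn_integral_cong)
  have iu: "integrable \<mu> u" and eu: "integral\<^sup>L \<mu> u = 1"
    using u1 u0 by (auto simp: integrable_iff_bounded integral_eq_nn_integral)
  have ed: "entropy_density (exp 1) \<mu> \<nu> = (\<lambda>x. ln (u x))"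
    by (auto simp: entropy_density_def u_def log_def)
  have il: "integrable \<mu> (\<lambda>x. u x * ln (u x))"
    using int unfolding ed by (subst (asm) d[symmetric]) (simp add: integrable_density u0)
  have KL': "KL_divergence (exp 1) \<mu> \<nu> = (\<integral>x. u x * ln (u x) \<partial>\<mu>)"
    unfolding KL_divergence_def ed by (subst (1) d[symmetric]) (simp add: integral_density u0)
  have "(\<integral>\<^sup>+x. ennreal (u x * ln (u x) - u x + 1) \<partial>\<mu>) = ennreal (\<integral>x. u x * ln (u x) - u x + 1 \<partial>\<mu>)"
    using il iu entropy_integrand_nonneg[OF u0] by (intro nn_integral_eq_integral) auto
  also have "(\<integral>x. u x * ln (u x) - u x + 1 \<partial>\<mu>) = KL_divergence (exp 1) \<mu> \<nu>"
    using il iu eu by (simp add: KL' prob_space)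
  finally have h: "(\<integral>\<^sup>+x. ennreal (u x * ln (u x) - u x + 1) \<partial>\<mu>) = ennreal (KL_divergence (exp 1) \<mu> \<nu>)" .
  have "0 \<le> (\<integral>x. u x * ln (u x) - u x + 1 \<partial>\<mu>)"
    using entropy_integrand_nonneg[OF u0] by (intro Bochner_Integration.integral_nonneg) auto
  then have "0 \<le> KL_divergence (exp 1) \<mu> \<nu>"
    using il iu eu by (simp add: KL' prob_space)
  then show thesis using that[of u] u0 d u1 h KL by simp
qed

text \<open>The slack \<open>h < h'\<close> covers \<open>h = 0\<close>, where the optimal parameter of the pointwise bounds
  degenerates. The split at \<open>h = 1\<close> is needed because the small-entropy bound grows
  linearly in \<open>h\<close>.\<close>
lemma weighted_pinsker:
  assumes \<mu>: "prob_space \<mu>" and [measurable]: "u \<in> borel_measurable \<mu>" "\<phi> \<in> borel_measurable \<mu>"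
    and u0: "\<And>x. 0 \<le> u x" and p0: "\<And>x. 0 \<le> \<phi> x" and u1: "(\<integral>\<^sup>+x. ennreal (u x) \<partial>\<mu>) = 1"
    and h: "(\<integral>\<^sup>+x. ennreal (u x * ln (u x) - u x + 1) \<partial>\<mu>) = ennreal h" "0 \<le> h" "h < h'"
    and \<alpha>: "0 < \<alpha>" and C: "(\<integral>\<^sup>+x. ennreal (exp (\<alpha> * (\<phi> x)\<^sup>2)) \<partial>\<mu>) \<le> ennreal C" "0 \<le> C"
  shows "(\<integral>\<^sup>+x. ennreal (\<phi> x * \<bar>u x - 1\<bar>) \<partial>\<mu>) \<le> ennreal ((3 / 2 + C) * sqrt (h' / \<alpha>))"
proof -
  interpret prob_space \<mu> by fact
  define k where "k x = u x * ln (u x) - u x + 1" for x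
  have [measurable]: "k \<in> borel_measurable \<mu>" unfolding k_def by measurable
  have k0: "0 \<le> k x" for x using entropy_integrand_nonneg[OF u0] by (simp add: k_def)
  define e where "e x = exp (\<alpha> * (\<phi> x)\<^sup>2)" for x
  have [measurable]: "e \<in> borel_measurable \<mu>" unfolding e_def by measurable
  have e0: "0 \<le> e x" for x by (simp add: e_def)
  have ke: "(\<integral>\<^sup>+x. ennreal (k x + 2 * e x) \<partial>\<mu>) \<le> ennreal (h + 2 * C)"
  proof -
    have "(\<integral>\<^sup>+x. ennreal (k x + 2 * e x) \<partial>\<mu>) = (\<integral>\<^sup>+x. ennreal (k x) + 2 * ennreal (e x) \<partial>\<mu>)"
      using k0 e0 by (intro nn_integral_cong) (simp add: ennreal_mult)
    also have "\<dots> = ennreal h + 2 * (\<integral>\<^sup>+x. ennreal (e x) \<partial>\<mu>)"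
      using h by (simp add: nn_integral_add nn_integral_cmult k_def)
    also have "\<dots> \<le> ennreal h + 2 * ennreal C"
      using C by (intro add_left_mono mult_left_mono) (auto simp: e_def)
    finally show ?thesis using h C by (simp add: ennreal_mult)
  qed
  have h': "0 < h'" using h by simp
  define s where "s = sqrt (h' / \<alpha>)"
  have s: "0 < s" "s\<^sup>2 = h' / \<alpha>" using h' \<alpha> by (auto simp: s_def)
  show ?thesis
  proof (cases "h \<le> 1")
    case True
    \<comment> \<open>Balances the two terms of the pointwise bound: \<open>h' / l = s\<close> and \<open>l / \<alpha> = s\<close>.\<close>
    define l where "l = \<alpha> * s"
    have l: "0 < l" using s \<alpha> by (simp add: l_def)
    have hl: "h' / l = s" using s \<alpha> by (simp add: l_def power2_eq_square field_simps)
    have "(\<integral>\<^sup>+x. ennreal (\<phi> x * \<bar>u x - 1\<bar>) \<partial>\<mu>) \<le>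
        (\<integral>\<^sup>+x. ennreal (1 / l) * ennreal (k x) + ennreal (l / (2 * \<alpha>)) * ennreal (k x + 2 * e x) \<partial>\<mu>)"
    proof (intro nn_integral_mono)
      fix x
      have "\<phi> x * \<bar>u x - 1\<bar> \<le> 1 / l * k x + l / (2 * \<alpha>) * (k x + 2 * e x)"
        using weighted_deviation_small[OF u0 p0 \<alpha> l, of x x] by (simp add: k_def e_def)
      then show "ennreal (\<phi> x * \<bar>u x - 1\<bar>) \<le> ennreal (1 / l) * ennreal (k x) + ennreal (l / (2 * \<alpha>)) * ennreal (k x + 2 * e x)"
        using l \<alpha> k0[of x] e0[of x] by (simp flip: ennreal_mult ennreal_plus)
    qed
    also have "\<dots> = ennreal (1 / l) * ennreal h + ennreal (l / (2 * \<alpha>)) * (\<integral>\<^sup>+x. ennreal (k x + 2 * e x) \<partial>\<mu>)"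
      using h by (simp add: nn_integral_add nn_integral_cmult k_def)
    also have "\<dots> \<le> ennreal (1 / l) * ennreal h + ennreal (l / (2 * \<alpha>)) * ennreal (h + 2 * C)"
      by (intro add_left_mono mult_left_mono ke) simp
    also have "\<dots> = ennreal (h / l + s / 2 * (h + 2 * C))"
    proof -
      have "l / (2 * \<alpha>) = s / 2" using \<alpha> by (simp add: l_def)
      then show ?thesis unfolding \<open>l / (2 * \<alpha>) = s / 2\<close> using l s h C by (simp flip: ennreal_mult ennreal_plus)
    qed
    also have "\<dots> \<le> ennreal ((3 / 2 + C) * s)"
    proof (rule ennreal_leI)
      have "h / l \<le> h' / l" using h l by (intro divide_right_mono) auto
      moreover have "s / 2 * (h + 2 * C) \<le> s / 2 * (1 + 2 * C)" using s True by (intro mult_left_mono) auto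
      moreover have "s + s / 2 * (1 + 2 * C) = (3 / 2 + C) * s" by (simp add: algebra_simps)
      ultimately show "h / l + s / 2 * (h + 2 * C) \<le> (3 / 2 + C) * s" unfolding hl by linarith
    qed
    finally show ?thesis by (simp add: s_def)
  next
    case False
    define r where "r = 1 / (2 * \<alpha> * s)"
    have r: "0 < r" using s \<alpha> by (simp add: r_def)
    have "(\<integral>\<^sup>+x. ennreal (\<phi> x * \<bar>u x - 1\<bar>) \<partial>\<mu>) \<le>
        (\<integral>\<^sup>+x. ennreal (s / 2) * (1 + ennreal (u x)) + ennreal r * ennreal (k x + 2 * e x) \<partial>\<mu>)"
    proof (intro nn_integral_mono)
      fix x
      have "\<phi> x * \<bar>u x - 1\<bar> \<le> s / 2 * (1 + u x) + r * (k x + 2 * e x)"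
        using weighted_deviation_large[OF u0 p0 \<alpha> s(1), of x x] by (simp add: k_def e_def r_def)
      then show "ennreal (\<phi> x * \<bar>u x - 1\<bar>) \<le> ennreal (s / 2) * (1 + ennreal (u x)) + ennreal r * ennreal (k x + 2 * e x)"
        using s r k0[of x] e0[of x] u0[of x] by (simp flip: ennreal_mult ennreal_plus ennreal_1)
    qed
    also have "\<dots> = ennreal (s / 2) * 2 + ennreal r * (\<integral>\<^sup>+x. ennreal (k x + 2 * e x) \<partial>\<mu>)"
      by (simp add: nn_integral_add nn_integral_cmult u1 emeasure_space_1)
    also have "\<dots> \<le> ennreal (s / 2) * 2 + ennreal r * ennreal (h + 2 * C)"
      by (intro add_left_mono mult_left_mono ke) simp
    also have "\<dots> = ennreal (s + r * (h + 2 * C))"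
    proof -
      have "ennreal (s / 2) * 2 = ennreal s" 
        using s by (simp add: ennreal_mult''[symmetric] flip: ennreal_numeral)
      then show ?thesis using s r h C by (simp flip: ennreal_mult ennreal_plus)
    qed
    also have "\<dots> \<le> ennreal ((3 / 2 + C) * s)"
    proof (rule ennreal_leI)
      have "C \<le> C * h'" using False h C mult_left_mono[of 1 h' C] by simp
      then have "h + 2 * C \<le> (1 + 2 * C) * h'" using h by (simp add: algebra_simps)
      then have "r * (h + 2 * C) \<le> r * ((1 + 2 * C) * h')" using r by simp
      also have "r * ((1 + 2 * C) * h') = (1 / 2 + C) * (h' / \<alpha> / s)" using s \<alpha> by (simp add: r_def field_simps)
      also have "h' / \<alpha> / s = s" unfolding s(2)[symmetric] using s(1) by (simp add: power2_eq_square)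
      finally show "s + r * (h + 2 * C) \<le> (3 / 2 + C) * s" by (simp add: algebra_simps)
    qed
    finally show ?thesis by (simp add: s_def)
  qed
qed

theorem transport_ineq_of_exp_moment:
  assumes \<mu>: "prob_space \<mu>" and s: "sets \<mu> = sets (metric_borel m)" and x0: "x0 \<in> mspace m"
    and d: "(\<lambda>(x, y). mdist m x y) \<in> borel_measurable (metric_borel m \<Otimes>\<^sub>M metric_borel m)"
    and \<alpha>: "0 < \<alpha>" and C: "(\<integral>\<^sup>+x. ennreal (exp (\<alpha> * (mdist m x0 x)\<^sup>2)) \<partial>\<mu>) \<le> ennreal C" "0 \<le> C"
  shows "transport_ineq 1 ((3 / 2 + C)\<^sup>2 / (2 * \<alpha>)) m \<mu>"
  unfolding transport_ineq_def
proof (intro allI impI, elim conjE)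
  fix \<nu> :: "'a measure" assume \<nu>: "prob_space \<nu>" and s\<nu>: "sets \<nu> = sets (metric_borel m)"
  let ?h = "real_of_ereal (rel_entropy \<nu> \<mu>)"
  show "wasserstein 1 m \<mu> \<nu> \<le> (if rel_entropy \<nu> \<mu> = \<infinity> then \<top>
           else ennreal (sqrt (2 * ((3 / 2 + C)\<^sup>2 / (2 * \<alpha>)) * ?h)))"
  proof (cases "rel_entropy \<nu> \<mu> = \<infinity>")
    case False
    obtain u where [measurable]: "u \<in> borel_measurable \<mu>" and u: "\<And>x. 0 \<le> u x" "density \<mu> (\<lambda>x. ennreal (u x)) = \<nu>"
      "(\<integral>\<^sup>+x. ennreal (u x) \<partial>\<mu>) = 1"
      "(\<integral>\<^sup>+x. ennreal (u x * ln (u x) - u x + 1) \<partial>\<mu>) = ennreal ?h" "0 \<le> ?h"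
      using s s\<nu> by (elim entropy_as_integral[OF \<mu> \<nu> _ False, rotated]) auto
    have x0': "x0 \<in> space (metric_borel m)" using x0 by simp
    have [measurable]: "(\<lambda>x. mdist m x0 x) \<in> borel_measurable \<mu>"
      using measurable_compose[OF measurable_Pair1'[OF x0', of "metric_borel m"] d] s
      by (simp cong: measurable_cong_sets)
    have "wasserstein 1 m \<mu> \<nu> \<le>
        ennreal_root 1 (\<integral>\<^sup>+(x, y). ennreal (mdist m x y powr 1) \<partial>overlap_coupling \<mu> u)"
      unfolding wasserstein_def
      using overlap_coupling_in_couplings[OF \<mu> s _ u(3)] u(2) by (intro INF_lower) simp
    also have "\<dots> = (\<integral>\<^sup>+(x, y). ennreal (mdist m x y) \<partial>overlap_coupling \<mu> u)"
      by (auto simp: ennreal_root_def less_top cong: nn_integral_cong)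
    also have "\<dots> \<le> (\<integral>\<^sup>+x. ((1 - ennreal (u x)) + (ennreal (u x) - 1)) * ennreal (mdist m x0 x) \<partial>\<mu>)"
      by (rule overlap_coupling_cost[OF \<mu> s _ u(3) x0 d]) simp
    also have "\<dots> = (\<integral>\<^sup>+x. ennreal (mdist m x0 x * \<bar>u x - 1\<bar>) \<partial>\<mu>)"
    proof (intro nn_integral_cong)
      fix x
      have "1 - ennreal (u x) + (ennreal (u x) - 1) = ennreal (max 0 (1 - u x) + max 0 (u x - 1))"
        using u(1)[of x] by (simp add: ennreal_minus max_def ennreal_neg flip: ennreal_1)
      also have "max 0 (1 - u x) + max 0 (u x - 1) = \<bar>u x - 1\<bar>" by simp
      finally show "(1 - ennreal (u x) + (ennreal (u x) - 1)) * ennreal (mdist m x0 x) =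
          ennreal (mdist m x0 x * \<bar>u x - 1\<bar>)"
        by (simp add: ennreal_mult mult.commute)
    qed
    finally have W: "wasserstein 1 m \<mu> \<nu> \<le> (\<integral>\<^sup>+x. ennreal (mdist m x0 x * \<bar>u x - 1\<bar>) \<partial>\<mu>)" .
    have "wasserstein 1 m \<mu> \<nu> \<le> ennreal ((3 / 2 + C) * sqrt ((?h + 1 / Suc n) / \<alpha>))" for n
      using W weighted_pinsker[OF \<mu> _ _ u(1) mdist_nonneg u(3,4,5) _ \<alpha> C, of "?h + 1 / Suc n"]
      by (auto intro: order_trans)
    moreover have "(\<lambda>n. ennreal ((3 / 2 + C) * sqrt ((?h + 1 / Suc n) / \<alpha>))) \<longlonglongrightarrow>
       ennreal ((3 / 2 + C) * sqrt ((?h + 0) / \<alpha>))"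
      using \<alpha> by (intro tendsto_ennrealI tendsto_intros LIMSEQ_Suc[OF lim_1_over_n]) auto
    ultimately have "wasserstein 1 m \<mu> \<nu> \<le> ennreal ((3 / 2 + C) * sqrt ((?h + 0) / \<alpha>))"
      by (intro LIMSEQ_le_const) auto
    also have "(3 / 2 + C) * sqrt ((?h + 0) / \<alpha>) = sqrt (2 * ((3 / 2 + C)\<^sup>2 / (2 * \<alpha>)) * ?h)"
      using C(2) \<alpha> by (simp add: real_sqrt_mult real_sqrt_divide)
    finally show ?thesis using False by simp
  qed simp
qed

text \<open>Lets the case of vanishing noise be reached as a limit of nondegenerate scales.\<close>
lemma transport_ineq_closed:
  assumes C: "0 \<le> C" and T: "\<And>C'. C < C' \<Longrightarrow> transport_ineq p C' m \<mu>"
  shows "transport_ineq p C m \<mu>"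
  unfolding transport_ineq_def
proof (intro allI impI)
  fix \<nu> :: "'a measure" assume \<nu>: "prob_space \<nu> \<and> sets \<nu> = sets (metric_borel m)"
  let ?h = "real_of_ereal (rel_entropy \<nu> \<mu>)"
  show "wasserstein p m \<mu> \<nu> \<le> (if rel_entropy \<nu> \<mu> = \<infinity> then \<top> else ennreal (sqrt (2 * C * ?h)))"
  proof (cases "rel_entropy \<nu> \<mu> = \<infinity>")
    case False
    have "wasserstein p m \<mu> \<nu> \<le> ennreal (sqrt (2 * (C + 1 / Suc n) * ?h))" for n
      using T[of "C + 1 / Suc n"] \<nu> False unfolding transport_ineq_def by auto
    moreover have "(\<lambda>n. ennreal (sqrt (2 * (C + 1 / Suc n) * ?h))) \<longlonglongrightarrow> ennreal (sqrt (2 * (C + 0) * ?h))"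
      by (intro tendsto_ennrealI tendsto_intros LIMSEQ_Suc[OF lim_1_over_n])
    ultimately have "wasserstein p m \<mu> \<nu> \<le> ennreal (sqrt (2 * (C + 0) * ?h))"
      by (intro LIMSEQ_le_const) auto
    then show ?thesis using False by simp
  qed simp
qed

section \<open>Dyadic points and the Borel structure of the path space\<close>

definition dyadic :: "real \<Rightarrow> nat \<Rightarrow> nat \<Rightarrow> real" where
  "dyadic T n k = real k * T / 2 ^ n"

lemma dyadic_0 [simp]: "dyadic T n 0 = 0"
  by (simp add: dyadic_def)

lemma dyadic_mem: "0 \<le> T \<Longrightarrow> k \<le> 2 ^ n \<Longrightarrow> dyadic T n k \<in> {0..T}"
proof -
  assume "0 \<le> T" "k \<le> 2 ^ n"
  then have "real k * T \<le> 2 ^ n * T"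
    by (intro mult_right_mono) auto
  then show ?thesis using \<open>0 \<le> T\<close> by (simp add: dyadic_def field_simps)
qed

lemma dyadic_approx:
  assumes T: "0 < T" and t: "t \<in> {0..T}"
  obtains k where "k \<le> 2 ^ n" "\<bar>t - dyadic T n k\<bar> \<le> T / 2 ^ n"
proof -
  define k where "k = nat \<lfloor>t / T * 2 ^ n\<rfloor>"
  have p: "0 \<le> t / T * 2 ^ n" "t / T * 2 ^ n \<le> 2 ^ n" using t T by (auto simp: field_simps)
  have k: "real k \<le> t / T * 2 ^ n" "t / T * 2 ^ n \<le> real k + 1" using p(1) by (auto simp: k_def)
  have "real k \<le> 2 ^ n" using k(1) p(2) by linarith
  then have "k \<le> 2 ^ n" by simp
  moreover have "\<bar>t - dyadic T n k\<bar> \<le> T / 2 ^ n"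
  proof -
    have "t - dyadic T n k = (t / T * 2 ^ n - real k) * (T / 2 ^ n)"
      using T by (simp add: dyadic_def field_simps)
    also have "\<bar>\<dots>\<bar> \<le> 1 * (T / 2 ^ n)"
      unfolding abs_mult using k T by (intro mult_mono) auto
    finally show ?thesis by simp
  qed
  ultimately show thesis by (rule that)
qed

text \<open>Countably many time points suffice to control a continuous path, which gives measurability of
  suprema over time.\<close>
lemma le_of_dyadic_le:
  fixes g :: "real \<Rightarrow> real"
  assumes T: "0 < T" and g: "continuous_on {0..T} g"
    and le: "\<And>n k. k \<le> 2 ^ n \<Longrightarrow> g (dyadic T n k) \<le> c" and t: "t \<in> {0..T}"
  shows "g t \<le> c"
proof -
  have "\<forall>n. \<exists>k. k \<le> 2 ^ n \<and> \<bar>t - dyadic T n k\<bar> \<le> T / 2 ^ n"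
    using dyadic_approx[OF T t] by metis
  then obtain k where k: "\<And>n. k n \<le> 2 ^ n" "\<And>n. \<bar>t - dyadic T n (k n)\<bar> \<le> T / 2 ^ n" by metis
  have "(\<lambda>n. T / 2 ^ n) \<longlonglongrightarrow> 0" by (rule LIMSEQ_divide_realpow_zero) simp
  then have "(\<lambda>n. dyadic T n (k n) - t) \<longlonglongrightarrow> 0"
    by (rule Lim_null_comparison[rotated]) (use k(2) in \<open>simp add: abs_minus_commute\<close>)
  then have "(\<lambda>n. dyadic T n (k n)) \<longlonglongrightarrow> t" by (simp add: LIM_zero_iff)
  then have "(\<lambda>n. g (dyadic T n (k n))) \<longlonglongrightarrow> g t"
    using t T k(1) by (intro continuous_on_tendsto_compose[OF g]) (auto intro!: always_eventually dyadic_mem simp del: atLeastAtMost_iff)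
  then show ?thesis
    by (rule LIMSEQ_le_const2) (use le k(1) in blast)
qed

lemma d_infty_le_iff_dyadic:
  assumes T: "0 < T" and f: "f \<in> paths T" "g \<in> paths T"
  shows "d_infty T f g \<le> c \<longleftrightarrow> (\<forall>n. \<forall>k\<in>{..2 ^ n}. norm (f (dyadic T n k) - g (dyadic T n k)) \<le> c)"
proof
  assume "d_infty T f g \<le> c"
  then show "\<forall>n. \<forall>k\<in>{..2 ^ n}. norm (f (dyadic T n k) - g (dyadic T n k)) \<le> c"
    using norm_le_d_infty[OF f dyadic_mem] T by (auto intro: order_trans)
next
  assume le: "\<forall>n. \<forall>k\<in>{..2 ^ n}. norm (f (dyadic T n k) - g (dyadic T n k)) \<le> c"
  have "continuous_on {0..T} (\<lambda>t. norm (f t - g t))"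
    using f by (auto simp: paths_def intro!: continuous_intros)
  then have "norm (f t - g t) \<le> c" if "t \<in> {0..T}" for t
    by (rule le_of_dyadic_le[OF T]) (use le that in auto)
  then show "d_infty T f g \<le> c" using T f by (intro d_infty_le) auto
qed

lemma openin_path_space:
  assumes "0 \<le> T"
  shows "openin (mtopology_of (path_space T)) U \<longleftrightarrow>
     U \<subseteq> paths T \<and> (\<forall>f\<in>U. \<exists>r>0. \<forall>g\<in>paths T. d_infty T f g < r \<longrightarrow> g \<in> U)"
proof -
  interpret Metric_space "paths T" "d_infty T" using Metric_space_paths[OF assms] .
  have "openin (mtopology_of (path_space T)) U = openin mtopology U"
    by (simp add: mtopology_of_def mspace_path_space mdist_path_space assms)
  also have "\<dots> \<longleftrightarrow> U \<subseteq> paths T \<and> (\<forall>f\<in>U. \<exists>r>0. mball f r \<subseteq> U)"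
    by (auto simp: openin_mtopology)
  also have "\<dots> \<longleftrightarrow> U \<subseteq> paths T \<and> (\<forall>f\<in>U. \<exists>r>0. \<forall>g\<in>paths T. d_infty T f g < r \<longrightarrow> g \<in> U)"
    by (intro conj_cong refl ball_cong ex_cong) (auto simp: subset_iff)
  finally show ?thesis .
qed

text \<open>Evaluation at a time is continuous for the supremum distance.\<close>
lemma measurable_eval_path [measurable (raw)]:
  fixes t :: real
  assumes T: "0 \<le> T" and t: "t \<in> {0..T}"
  shows "(\<lambda>f :: real \<Rightarrow> 'a :: euclidean_space. f t) \<in> borel_measurable (metric_borel (path_space T))"
proof (rule borel_measurableI)
  fix S :: "'a set" assume S: "open S"
  have "openin (mtopology_of (path_space T)) ((\<lambda>f. f t) -` S \<inter> paths T)"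
    unfolding openin_path_space[OF T]
  proof (intro conjI ballI)
    fix f assume f: "f \<in> (\<lambda>f. f t) -` S \<inter> paths T"
    then obtain r where r: "r > 0" "ball (f t) r \<subseteq> S" using S by (auto simp: open_contains_ball)
    have "g t \<in> S" if "g \<in> paths T" "d_infty T f g < r" for g
      using norm_le_d_infty[of f T g t] that f t r by (auto simp: subset_iff dist_norm)
    then show "\<exists>r>0. \<forall>g\<in>paths T. d_infty T f g < r \<longrightarrow> g \<in> (\<lambda>f. f t) -` S \<inter> paths T"
      using r(1) by auto
  qed auto
  then show "(\<lambda>f. f t) -` S \<inter> space (metric_borel (path_space T)) \<in> sets (metric_borel (path_space T))"
    by (simp add: sets_metric_borel mspace_path_space T sigma_sets.Basic)
qed

lemma measurable_dist_path_space:
  fixes T :: real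
  assumes T: "0 < T"
  defines "E \<equiv> metric_borel (path_space T :: (real \<Rightarrow> 'a :: euclidean_space) metric)"
  shows "(\<lambda>(f, g). mdist (path_space T) f g) \<in> borel_measurable (E \<Otimes>\<^sub>M E)"
proof (subst borel_measurable_iff_le, intro allI)
  fix c
  have [measurable]: "(\<lambda>w. fst w (dyadic T n k)) \<in> borel_measurable (E \<Otimes>\<^sub>M E)"
      "(\<lambda>w. snd w (dyadic T n k)) \<in> borel_measurable (E \<Otimes>\<^sub>M E)" if "k \<in> {..2 ^ n}" for n k
    using that T unfolding E_def
    by (auto intro!: measurable_compose[OF measurable_fst] measurable_compose[OF measurable_snd]
        measurable_eval_path dyadic_mem)
  have "{w \<in> space (E \<Otimes>\<^sub>M E). (case w of (f, g) \<Rightarrow> mdist (path_space T) f g) \<le> c} =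
     {w \<in> space (E \<Otimes>\<^sub>M E). \<forall>n. \<forall>k\<in>{..2 ^ n}. norm (fst w (dyadic T n k) - snd w (dyadic T n k)) \<le> c}"
    using T by (auto simp: space_pair_measure E_def mspace_path_space mdist_path_space d_infty_le_iff_dyadic)
  also have "\<dots> \<in> sets (E \<Otimes>\<^sub>M E)" by measurable
  finally show "{w \<in> space (E \<Otimes>\<^sub>M E). (case w of (f, g) \<Rightarrow> mdist (path_space T) f g) \<le> c} \<in> sets (E \<Otimes>\<^sub>M E)" .
qed

text \<open>For each modulus of continuity and each list of values from a countable dense set of the range,
  pick one path with that modulus whose values at the dyadic points of the corresponding level are
  close to the list. Two paths that match the same data are uniformly close, so the countably many
  chosen paths are dense.\<close>
lemma paths_separable:
  assumes T: "0 < T"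
  obtains D :: "(real \<Rightarrow> 'a :: euclidean_space) set"
  where "countable D" "D \<subseteq> paths T" "\<And>g e. g \<in> paths T \<Longrightarrow> 0 < e \<Longrightarrow> \<exists>f\<in>D. d_infty T f g < e"
proof -
  obtain Q :: "'a set" where Q: "countable Q" "\<And>X. open X \<Longrightarrow> X \<noteq> {} \<Longrightarrow> \<exists>d\<in>Q. d \<in> X"
    using countable_dense_exists by blast
  define P where "P = (\<lambda>(n :: nat, m :: nat, r :: 'a list) f. f \<in> paths T \<and>
     (\<forall>s\<in>{0..T}. \<forall>t\<in>{0..T}. \<bar>s - t\<bar> \<le> T / 2 ^ m \<longrightarrow> norm (f s - f t) \<le> 1 / Suc n) \<and>
     (\<forall>k\<le>2 ^ m. norm (f (dyadic T m k) - r ! k) \<le> 1 / Suc n))"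
  define I where "I = {i \<in> UNIV \<times> UNIV \<times> lists Q. \<exists>f. P i f}"
  define D where "D = (\<lambda>i. SOME f. P i f) ` I"
  have P: "P i (SOME f. P i f)" if "i \<in> I" for i
    using that someI_ex[of "P i"] by (auto simp: I_def)
  have "countable I"
    unfolding I_def by (intro countable_Collect countable_SIGMA countable_lists Q(1)) auto
  then have "countable D" by (simp add: D_def)
  moreover have "D \<subseteq> paths T" using P by (fastforce simp: D_def P_def split_beta)
  moreover have "\<exists>f\<in>D. d_infty T f g < e" if g: "g \<in> paths T" and e: "0 < e" for g e
  proof -
    obtain n where n: "inverse (real (Suc n)) < e / 4" using reals_Archimedean[of "e / 4"] e by auto
    define \<delta> where "\<delta> = 1 / real (Suc n)"
    have \<delta>: "0 < \<delta>" "4 * \<delta> < e" using n by (auto simp: \<delta>_def inverse_eq_divide)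
    have "uniformly_continuous_on {0..T} g"
      using g by (intro compact_uniformly_continuous) (auto simp: paths_def)
    then obtain d where d: "0 < d" "\<And>s t. s \<in> {0..T} \<Longrightarrow> t \<in> {0..T} \<Longrightarrow> dist s t < d \<Longrightarrow> dist (g s) (g t) < \<delta>"
      using \<delta>(1) unfolding uniformly_continuous_on_def by blast
    have "(\<lambda>m. T / 2 ^ m) \<longlonglongrightarrow> 0" by (rule LIMSEQ_divide_realpow_zero) simp
    then have "eventually (\<lambda>m. T / 2 ^ m < d) sequentially" using d(1) by (rule order_tendstoD)
    then obtain m where m: "T / 2 ^ m < d" by (auto simp: eventually_sequentially)
    have "\<exists>q\<in>Q. q \<in> ball (g (dyadic T m k)) \<delta>" for k using \<delta> by (intro Q(2)) auto
    then obtain q where q: "\<And>k. q k \<in> Q" "\<And>k. dist (g (dyadic T m k)) (q k) < \<delta>"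
      by (metis mem_ball)
    define r where "r = map q [0..<2 ^ m + 1]"
    have rk: "r ! k = q k" if "k \<le> 2 ^ m" for k using that unfolding r_def by (subst nth_map) (auto simp del: upt_Suc)
    have "P (n, m, r) g"
      using g d(2) m q(2) unfolding P_def prod.case \<delta>_def[symmetric]
      by (auto simp: rk dist_norm intro!: less_imp_le)
    then have "(n, m, r) \<in> I" using q(1) by (auto simp: I_def r_def)
    define f where "f = (SOME f. P (n, m, r) f)"
    have "f \<in> D" using \<open>(n, m, r) \<in> I\<close> by (auto simp: D_def f_def)
    have Pf: "P (n, m, r) f" using P[OF \<open>(n, m, r) \<in> I\<close>] by (simp add: f_def)
    have "d_infty T f g \<le> 4 * \<delta>"
    proof (rule d_infty_le)
      fix t assume t: "t \<in> {0..T}"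
      obtain k where k: "k \<le> 2 ^ m" "\<bar>t - dyadic T m k\<bar> \<le> T / 2 ^ m" using dyadic_approx[OF T t] by metis
      let ?s = "dyadic T m k"
      have s: "?s \<in> {0..T}" using k T by (intro dyadic_mem) auto
      have 1: "norm (f t - f ?s) \<le> \<delta>" "norm (f ?s - q k) \<le> \<delta>"
        using Pf k s t unfolding P_def \<delta>_def by (auto simp: rk)
      have 2: "norm (g t - g ?s) \<le> \<delta>" "norm (g ?s - q k) \<le> \<delta>"
        using d(2)[OF t s] q(2)[of k] k m by (auto simp: dist_norm)
      have "f t - g t = (f t - f ?s) + (f ?s - q k) - (g ?s - q k) - (g t - g ?s)" by simp
      also have "norm \<dots> \<le> norm (f t - f ?s) + norm (f ?s - q k) + norm (g ?s - q k) + norm (g t - g ?s)"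
        by (smt (verit) norm_triangle_ineq norm_triangle_ineq4)
      finally show "norm (f t - g t) \<le> 4 * \<delta>" using 1 2 by linarith
    qed (use T g Pf in \<open>auto simp: P_def\<close>)
    then show ?thesis using \<open>f \<in> D\<close> \<delta> by force
  qed
  ultimately show thesis by (rule that)
qed

text \<open>By separability an open set of paths is a countable union of closed balls, and membership in a
  closed ball is a condition on the values at dyadic times.\<close>
lemma measurable_into_path_space:
  fixes \<gamma> :: "'w \<Rightarrow> real \<Rightarrow> 'a :: euclidean_space"
  assumes T: "0 < T" and p: "\<And>\<omega>. \<omega> \<in> space M \<Longrightarrow> \<gamma> \<omega> \<in> paths T"
    and m: "\<And>t. t \<in> {0..T} \<Longrightarrow> (\<lambda>\<omega>. \<gamma> \<omega> t) \<in> borel_measurable M"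
  shows "\<gamma> \<in> M \<rightarrow>\<^sub>M metric_borel (path_space T)"
proof (rule measurable_sigma_sets[OF sets_metric_borel])
  show "{U. openin (mtopology_of (path_space T)) U} \<subseteq> Pow (mspace (path_space T))"
    by (auto dest!: openin_subset simp: topspace_mtopology_of)
  show "\<gamma> \<in> space M \<rightarrow> mspace (path_space T)" using p T by (auto simp: mspace_path_space)
  fix U :: "(real \<Rightarrow> 'a) set" assume "U \<in> {U. openin (mtopology_of (path_space T)) U}"
  then have U: "U \<subseteq> paths T" "\<And>f. f \<in> U \<Longrightarrow> \<exists>r>0. \<forall>g\<in>paths T. d_infty T f g < r \<longrightarrow> g \<in> U"
    using openin_path_space[of T U] T by auto
  interpret Metric_space "paths T :: (real \<Rightarrow> 'a) set" "d_infty T" using Metric_space_paths[OF less_imp_le[OF T]] .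
  obtain D :: "(real \<Rightarrow> 'a) set" where D: "countable D" "D \<subseteq> paths T"
      "\<And>g e. g \<in> paths T \<Longrightarrow> 0 < e \<Longrightarrow> \<exists>f\<in>D. d_infty T f g < e"
    using paths_separable[OF T] by metis
  define S where "S = {(f, j :: nat) \<in> D \<times> UNIV. \<forall>g\<in>paths T. d_infty T f g \<le> 1 / Suc j \<longrightarrow> g \<in> U}"
  have "\<gamma> -` U \<inter> space M = (\<Union>(f, j)\<in>S. {\<omega> \<in> space M. d_infty T f (\<gamma> \<omega>) \<le> 1 / Suc j})"
  proof (intro equalityI subsetI)
    fix \<omega> assume "\<omega> \<in> \<gamma> -` U \<inter> space M"
    then have \<omega>: "\<omega> \<in> space M" "\<gamma> \<omega> \<in> U" "\<gamma> \<omega> \<in> paths T" using U by auto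
    obtain r where r: "0 < r" "\<And>g. g \<in> paths T \<Longrightarrow> d_infty T (\<gamma> \<omega>) g < r \<Longrightarrow> g \<in> U" using U(2)[OF \<omega>(2)] by auto
    obtain j where "inverse (real (Suc j)) < r / 2" using reals_Archimedean[of "r / 2"] r(1) by auto
    then have j': "2 * (1 / real (Suc j)) < r" by (simp add: inverse_eq_divide)
    obtain f where f: "f \<in> D" "d_infty T f (\<gamma> \<omega>) < 1 / Suc j" using D(3)[OF \<omega>(3), of "1 / Suc j"] by auto
    have "(f, j) \<in> S"
    proof -
      have "g \<in> U" if "g \<in> paths T" "d_infty T f g \<le> 1 / Suc j" for g
        using r(2)[OF that(1)] triangle[OF \<omega>(3) _ that(1), of f] that f D(2) j' commute[of f "\<gamma> \<omega>"] by fastforce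
      then show ?thesis using f by (auto simp: S_def)
    qed
    then show "\<omega> \<in> (\<Union>(f, j)\<in>S. {\<omega> \<in> space M. d_infty T f (\<gamma> \<omega>) \<le> 1 / Suc j})"
      using \<omega> f by (auto intro!: bexI[of _ "(f, j)"])
  qed (use p in \<open>auto simp: S_def\<close>)
  also have "\<dots> \<in> sets M"
  proof (rule sets.countable_UN'')
    have "S \<subseteq> D \<times> UNIV" by (auto simp: S_def)
    then show "countable S" by (rule countable_subset) (intro countable_SIGMA D(1) countableI_type)
  next
    have [measurable]: "(\<lambda>\<omega>. \<gamma> \<omega> (dyadic T n k)) \<in> borel_measurable M" if "k \<in> {..2 ^ n}" for n k
      using that T by (intro m dyadic_mem) auto
    have "{\<omega> \<in> space M. d_infty T f (\<gamma> \<omega>) \<le> 1 / Suc j} =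
       {\<omega> \<in> space M. \<forall>n. \<forall>k\<in>{..2 ^ n}. norm (f (dyadic T n k) - \<gamma> \<omega> (dyadic T n k)) \<le> 1 / Suc j}"
      if "f \<in> D" for f j
      using that D p T by (auto simp: d_infty_le_iff_dyadic subset_iff)
    moreover have "{\<omega> \<in> space M. \<forall>n. \<forall>k\<in>{..2 ^ n}. norm (f (dyadic T n k) - \<gamma> \<omega> (dyadic T n k)) \<le> 1 / Suc j} \<in> sets M"
      for f :: "real \<Rightarrow> 'a" and j :: nat by measurable
    ultimately show "(case s of (f, j) \<Rightarrow> {\<omega> \<in> space M. d_infty T f (\<gamma> \<omega>) \<le> 1 / Suc j}) \<in> sets M" if "s \<in> S" for s
      using that by (auto simp: S_def)
  qed
  finally show "\<gamma> -` U \<inter> space M \<in> sets M" .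
qed

section \<open>Square-exponential moments of centered Gaussian variables\<close>

lemma (in prob_space) gaussian_rv_integrable:
  assumes "gaussian_rv M Y"
  shows "integrable M Y" "integrable M (\<lambda>\<omega>. (Y \<omega>)\<^sup>2)"
proof -
  have "integrable M Y \<and> integrable M (\<lambda>\<omega>. (Y \<omega>)\<^sup>2)"
    using assms unfolding gaussian_rv_def
  proof (elim disjE exE conjE)
    fix m s :: real assume s: "0 < s" and d: "distributed M lborel Y (normal_density m s)"
    have 1: "integrable M Y"
      using integrable_normal_moment_nz_1[OF s, of m] distributed_integrable[OF d, of "\<lambda>x. x"]
      by (simp add: normal_density_nonneg)
    have 2: "integrable M (\<lambda>\<omega>. (Y \<omega> - m)\<^sup>2)"
      using integrable_normal_moment[OF s, of m 2] distributed_integrable[OF d, of "\<lambda>x. (x - m)\<^sup>2"]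
      by (simp add: normal_density_nonneg)
    have "integrable M (\<lambda>\<omega>. (Y \<omega> - m)\<^sup>2 + 2 * m * Y \<omega> - m\<^sup>2)"
      using 1 2 by simp
    also have "(\<lambda>\<omega>. (Y \<omega> - m)\<^sup>2 + 2 * m * Y \<omega> - m\<^sup>2) = (\<lambda>\<omega>. (Y \<omega>)\<^sup>2)"
      by (auto simp: power2_eq_square algebra_simps)
    finally show ?thesis using 1 by simp
  next
    fix m assume m[measurable]: "Y \<in> borel_measurable M" and "AE \<omega> in M. Y \<omega> = m"
    then have "integrable M Y \<longleftrightarrow> integrable M (\<lambda>_. m)"
      by (intro integrable_cong_AE) auto
    moreover have "integrable M (\<lambda>\<omega>. (Y \<omega>)\<^sup>2) \<longleftrightarrow> integrable M (\<lambda>_. m\<^sup>2)"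
      using \<open>AE \<omega> in M. Y \<omega> = m\<close> by (intro integrable_cong_AE) auto
    ultimately show ?thesis by simp
  qed
  then show "integrable M Y" "integrable M (\<lambda>\<omega>. (Y \<omega>)\<^sup>2)" by auto
qed

lemma normal_density_times_exp_square:
  assumes "0 < s"
  shows "normal_density 0 s x * exp (x\<^sup>2 / (4 * s\<^sup>2)) = sqrt 2 * normal_density 0 (sqrt 2 * s) x"
proof -
  have "exp (- x\<^sup>2 / (2 * s\<^sup>2)) * exp (x\<^sup>2 / (4 * s\<^sup>2)) = exp (- x\<^sup>2 / (4 * s\<^sup>2))"
    by (simp add: mult_exp_exp field_simps)
  then show ?thesis
    using assms by (simp add: normal_density_def power_mult_distrib real_sqrt_mult field_simps)
qed

text \<open>A factor \<open>exp (x\<^sup>2 / (4 s\<^sup>2))\<close> turns the density of variance \<open>s\<^sup>2\<close> into \<open>\<surd>2\<close> times the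
  density of variance \<open>2 s\<^sup>2\<close>. A degenerate variable with mean 0 vanishes almost everywhere.\<close>
lemma (in prob_space) gaussian_exp_square:
  assumes Y: "gaussian_rv M Y" and mean: "expectation Y = 0" and var: "expectation (\<lambda>\<omega>. (Y \<omega>)\<^sup>2) \<le> v" and v: "0 < v"
  shows "(\<integral>\<^sup>+\<omega>. ennreal (exp ((Y \<omega>)\<^sup>2 / (4 * v))) \<partial>M) \<le> ennreal (sqrt 2)"
  using Y unfolding gaussian_rv_def
proof (elim disjE exE conjE)
  fix m s :: real assume s: "0 < s" and d: "distributed M lborel Y (normal_density m s)"
  have m: "m = 0" using normal_distributed_expectation[OF s d] mean by simp
  have s2: "s\<^sup>2 \<le> v" using normal_distributed_variance[OF s d] mean var by simp
  have "(\<integral>\<^sup>+\<omega>. ennreal (exp ((Y \<omega>)\<^sup>2 / (4 * v))) \<partial>M) \<le> (\<integral>\<^sup>+\<omega>. ennreal (exp ((Y \<omega>)\<^sup>2 / (4 * s\<^sup>2))) \<partial>M)"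
    using s s2 v by (intro nn_integral_mono ennreal_leI) (auto intro!: divide_left_mono)
  also have "\<dots> = (\<integral>\<^sup>+x. ennreal (normal_density 0 s x) * ennreal (exp (x\<^sup>2 / (4 * s\<^sup>2))) \<partial>lborel)"
    using d unfolding m by (subst distributed_nn_integral) auto
  also have "\<dots> = (\<integral>\<^sup>+x. ennreal (sqrt 2) * ennreal (normal_density 0 (sqrt 2 * s) x) \<partial>lborel)"
    using s by (intro nn_integral_cong) (simp add: normal_density_times_exp_square normal_density_nonneg flip: ennreal_mult)
  also have "\<dots> = ennreal (sqrt 2) * (\<integral>\<^sup>+x. ennreal (normal_density 0 (sqrt 2 * s) x) \<partial>lborel)"
    by (simp add: nn_integral_cmult)
  also have "(\<integral>\<^sup>+x. ennreal (normal_density 0 (sqrt 2 * s) x) \<partial>lborel) = 1"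
    using s by (simp add: nn_integral_eq_integral normal_density_nonneg)
  finally show ?thesis by simp
next
  fix m assume [measurable]: "Y \<in> borel_measurable M" and m: "AE \<omega> in M. Y \<omega> = m"
  have "expectation Y = expectation (\<lambda>_. m)" using m by (intro integral_cong_AE) auto
  then have "m = 0" using mean by (simp add: prob_space)
  then have "AE \<omega> in M. ennreal (exp ((Y \<omega>)\<^sup>2 / (4 * v))) = 1" using m by auto
  then have "(\<integral>\<^sup>+\<omega>. ennreal (exp ((Y \<omega>)\<^sup>2 / (4 * v))) \<partial>M) = (\<integral>\<^sup>+\<omega>. 1 \<partial>M)" by (intro nn_integral_cong_AE) auto
  also have "\<dots> = ennreal 1" by (simp add: emeasure_space_1)
  also have "\<dots> \<le> ennreal (sqrt 2)" by (intro ennreal_leI) simp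
  finally show ?thesis .
qed

section \<open>Second moments of Riemann sums against fractional Brownian motion\<close>

lemma powr_midpoint_le:
  fixes u v p :: real
  assumes "1 \<le> p" "0 \<le> u" "0 \<le> v"
  shows "2 * ((u + v) / 2) powr p \<le> u powr p + v powr p"
proof (cases "u = 0 \<or> v = 0")
  case True
  have "2 * (w / 2) powr p \<le> w powr p" if "0 \<le> w" for w :: real
  proof -
    have "2 powr 1 \<le> 2 powr p" using assms by (intro powr_mono) auto
    then have "2 * w powr p \<le> 2 powr p * w powr p" by (intro mult_right_mono) auto
    then show ?thesis using that by (simp add: powr_divide field_simps)
  qed
  then show ?thesis using True assms by auto
next
  case False
  then have "((1 - 1/2) *\<^sub>R u + (1/2) *\<^sub>R v) powr p \<le> (1 - 1/2) * u powr p + (1/2) * v powr p"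
    using assms by (intro convex_onD[OF powr_convex]) auto
  then show ?thesis by (simp add: field_simps)
qed

text \<open>Convexity of \<open>\<bar>\<cdot>\<bar>\<^sup>p\<close>, in the form in which it makes increments of fractional Brownian motion
  over cells of equal length nonnegatively correlated.\<close>
lemma abs_powr_second_difference_nonneg:
  fixes x h p :: real
  assumes "1 \<le> p"
  shows "2 * \<bar>x\<bar> powr p \<le> \<bar>x + h\<bar> powr p + \<bar>x - h\<bar> powr p"
proof -
  have "\<bar>x\<bar> powr p \<le> ((\<bar>x + h\<bar> + \<bar>x - h\<bar>) / 2) powr p"
    using assms by (intro powr_mono2) auto
  then show ?thesis using powr_midpoint_le[OF assms, of "\<bar>x + h\<bar>" "\<bar>x - h\<bar>"] by simp
qed

locale scalar_fbm = prob_space M for M :: "'w measure" +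
  fixes H T :: real and W :: "real \<Rightarrow> 'w \<Rightarrow> real"
  assumes H: "1 / 2 \<le> H" and T: "0 < T"
    and gaussian: "gaussian_process M {0..T} W"
    and mean: "\<And>t. t \<in> {0..T} \<Longrightarrow> expectation (W t) = 0"
    and cov: "\<And>s t. s \<in> {0..T} \<Longrightarrow> t \<in> {0..T} \<Longrightarrow> expectation (\<lambda>\<omega>. W s \<omega> * W t \<omega>) = fbm_cov H s t"
begin

lemma integrable_W: "t \<in> {0..T} \<Longrightarrow> integrable M (W t)" "t \<in> {0..T} \<Longrightarrow> integrable M (\<lambda>\<omega>. (W t \<omega>)\<^sup>2)"
proof -
  assume t: "t \<in> {0..T}"
  have "gaussian_rv M (\<lambda>\<omega>. \<Sum>s\<in>{t}. 1 * W s \<omega>)"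
    using gaussian[unfolded gaussian_process_def, rule_format, of "{t}" "\<lambda>_. 1"] t by simp
  then have "gaussian_rv M (W t)" by simp
  then show "integrable M (W t)" "integrable M (\<lambda>\<omega>. (W t \<omega>)\<^sup>2)" by (rule gaussian_rv_integrable)+
qed

lemma integrable_W_mult:
  assumes "s \<in> {0..T}" "t \<in> {0..T}" shows "integrable M (\<lambda>\<omega>. W s \<omega> * W t \<omega>)"
proof (rule Bochner_Integration.integrable_bound)
  show "integrable M (\<lambda>\<omega>. (W s \<omega>)\<^sup>2 + (W t \<omega>)\<^sup>2)" using integrable_W assms by simp
  show "(\<lambda>\<omega>. W s \<omega> * W t \<omega>) \<in> borel_measurable M"
    using integrable_W(1)[OF assms(1)] integrable_W(1)[OF assms(2)] by auto
  have "\<bar>a * b\<bar> \<le> a\<^sup>2 + b\<^sup>2" for a b :: real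
    using sum_squares_bound[of "\<bar>a\<bar>" "\<bar>b\<bar>"] abs_ge_zero[of "a * b"] unfolding abs_mult power2_abs by linarith
  then show "AE \<omega> in M. norm (W s \<omega> * W t \<omega>) \<le> norm ((W s \<omega>)\<^sup>2 + (W t \<omega>)\<^sup>2)" by simp
qed

lemma increment_cov:
  assumes "a \<in> {0..T}" "b \<in> {0..T}" "c \<in> {0..T}" "d \<in> {0..T}"
  shows "integrable M (\<lambda>\<omega>. (W b \<omega> - W a \<omega>) * (W d \<omega> - W c \<omega>))"
    "expectation (\<lambda>\<omega>. (W b \<omega> - W a \<omega>) * (W d \<omega> - W c \<omega>)) =
      (\<bar>b - c\<bar> powr (2 * H) + \<bar>a - d\<bar> powr (2 * H) - \<bar>b - d\<bar> powr (2 * H) - \<bar>a - c\<bar> powr (2 * H)) / 2"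
proof -
  have eq: "(\<lambda>\<omega>. (W b \<omega> - W a \<omega>) * (W d \<omega> - W c \<omega>)) =
     (\<lambda>\<omega>. W b \<omega> * W d \<omega> - W b \<omega> * W c \<omega> - W a \<omega> * W d \<omega> + W a \<omega> * W c \<omega>)"
    by (auto simp: algebra_simps)
  show "integrable M (\<lambda>\<omega>. (W b \<omega> - W a \<omega>) * (W d \<omega> - W c \<omega>))"
    unfolding eq using integrable_W_mult assms by simp
  show "expectation (\<lambda>\<omega>. (W b \<omega> - W a \<omega>) * (W d \<omega> - W c \<omega>)) =
      (\<bar>b - c\<bar> powr (2 * H) + \<bar>a - d\<bar> powr (2 * H) - \<bar>b - d\<bar> powr (2 * H) - \<bar>a - c\<bar> powr (2 * H)) / 2"
    unfolding eq using integrable_W_mult assms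
    by (simp add: cov fbm_cov_def abs_minus_commute field_simps)
qed

end

definition riemann_sum :: "(real \<Rightarrow> real) \<Rightarrow> (real \<Rightarrow> real) \<Rightarrow> real \<Rightarrow> nat \<Rightarrow> nat \<Rightarrow> nat \<Rightarrow> real" where
  "riemann_sum f g T n p q =
     (\<Sum>l=p..<q. f (dyadic T n l) * (g (dyadic T n (Suc l)) - g (dyadic T n l)))"

lemma dyadic_diff: "dyadic T n k - dyadic T n l = (real k - real l) * (T / 2 ^ n)"
  by (simp add: dyadic_def diff_divide_distrib algebra_simps)

lemma dyadic_Suc: "dyadic T n (Suc l) = dyadic T n l + T / 2 ^ n"
  by (simp add: dyadic_def add_divide_distrib algebra_simps)

lemma dyadic_refine: "dyadic T (n + N) (k * 2 ^ N) = dyadic T n k"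
  by (simp add: dyadic_def power_add)

context scalar_fbm
begin

lemma riemann_sum_gaussian:
  assumes q: "q \<le> 2 ^ n"
  shows "gaussian_rv M (\<lambda>\<omega>. riemann_sum f (\<lambda>t. W t \<omega>) T n p q)"
    and "expectation (\<lambda>\<omega>. riemann_sum f (\<lambda>t. W t \<omega>) T n p q) = 0"
proof -
  have mem: "dyadic T n l \<in> {0..T}" if "l \<le> q" for l using that q T by (intro dyadic_mem) auto
  define J where "J = dyadic T n ` {..q}"
  have J: "finite J" "J \<subseteq> {0..T}" using mem by (auto simp: J_def simp del: atLeastAtMost_iff)
  \<comment> \<open>The Riemann sum as a linear combination of values of \<open>W\<close> at distinct times, by collecting the
    coefficients of each grid point.\<close>
  define c where "c s = (\<Sum>l=p..<q. f (dyadic T n l) *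
     ((if s = dyadic T n (Suc l) then 1 else 0) - (if s = dyadic T n l then 1 else 0)))" for s
  have pick: "(\<Sum>s\<in>J. (if s = dyadic T n l then 1 else 0) * W s \<omega>) = W (dyadic T n l) \<omega>" if "l \<le> q" for l \<omega>
  proof -
    have "(\<Sum>s\<in>J. (if s = dyadic T n l then 1 else 0) * W s \<omega>) = (\<Sum>s\<in>J. if s = dyadic T n l then W s \<omega> else 0)"
      by (intro sum.cong) auto
    then show ?thesis using that J(1) by (auto simp: J_def)
  qed
  have "(\<Sum>s\<in>J. c s * W s \<omega>) = riemann_sum f (\<lambda>t. W t \<omega>) T n p q" for \<omega>
  proof -
    have "(\<Sum>s\<in>J. c s * W s \<omega>) = (\<Sum>l=p..<q. \<Sum>s\<in>J. f (dyadic T n l) *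
     ((if s = dyadic T n (Suc l) then 1 else 0) - (if s = dyadic T n l then 1 else 0)) * W s \<omega>)"
      unfolding c_def sum_distrib_right by (rule sum.swap)
    also have "\<dots> = (\<Sum>l=p..<q. f (dyadic T n l) *
     ((\<Sum>s\<in>J. (if s = dyadic T n (Suc l) then 1 else 0) * W s \<omega>) - (\<Sum>s\<in>J. (if s = dyadic T n l then 1 else 0) * W s \<omega>)))"
      by (simp only: sum_distrib_left mult.assoc left_diff_distrib right_diff_distrib sum_subtractf)
    also have "\<dots> = riemann_sum f (\<lambda>t. W t \<omega>) T n p q"
      unfolding riemann_sum_def by (intro sum.cong refl) (simp add: pick del: sum.delta)
    finally show ?thesis .
  qed
  then show "gaussian_rv M (\<lambda>\<omega>. riemann_sum f (\<lambda>t. W t \<omega>) T n p q)"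
    using gaussian[unfolded gaussian_process_def, rule_format, of J c] J by simp
  have "integrable M (\<lambda>\<omega>. W (dyadic T n l) \<omega>)" "expectation (W (dyadic T n l)) = 0" if "l \<le> q" for l
    using integrable_W(1) mean mem that by auto
  then show "expectation (\<lambda>\<omega>. riemann_sum f (\<lambda>t. W t \<omega>) T n p q) = 0"
    unfolding riemann_sum_def by (subst Bochner_Integration.integral_sum) auto
qed

text \<open>The second moment is a quadratic form in the values of \<open>f\<close> with nonnegative coefficients, so
  replacing \<open>f\<close> by the constant \<open>L\<close> can only enlarge it; for a constant integrand the sum
  telescopes to a single increment.\<close>
lemma riemann_sum_second_moment:
  assumes pq: "p \<le> q" "q \<le> 2 ^ n" and f: "\<And>t. t \<in> {0..T} \<Longrightarrow> \<bar>f t\<bar> \<le> L"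
  shows "expectation (\<lambda>\<omega>. (riemann_sum f (\<lambda>t. W t \<omega>) T n p q)\<^sup>2) \<le>
    L\<^sup>2 * (real (q - p) * (T / 2 ^ n)) powr (2 * H)"
proof -
  define D where "D l \<omega> = W (dyadic T n (Suc l)) \<omega> - W (dyadic T n l) \<omega>" for l \<omega>
  have mem: "dyadic T n l \<in> {0..T}" if "l \<le> q" for l using that pq T by (intro dyadic_mem) auto
  define I where "I = {p..<q}"
  have memI: "dyadic T n (Suc l) \<in> {0..T}" "dyadic T n l \<in> {0..T}" if "l \<in> I" for l
    using mem[of l] mem[of "Suc l"] that by (auto simp: I_def)
  define G where "G k l = expectation (\<lambda>\<omega>. D k \<omega> * D l \<omega>)" for k l
  have int: "integrable M (\<lambda>\<omega>. D k \<omega> * D l \<omega>)" if "k \<in> I" "l \<in> I" for k l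
    unfolding D_def using memI that by (intro increment_cov) auto
  have G0: "0 \<le> G k l" if kl: "k \<in> I" "l \<in> I" for k l
  proof -
    let ?x = "dyadic T n k - dyadic T n l" and ?h = "T / 2 ^ n"
    have "G k l = (\<bar>?x + ?h\<bar> powr (2 * H) + \<bar>?x - ?h\<bar> powr (2 * H) - 2 * \<bar>?x\<bar> powr (2 * H)) / 2"
      unfolding G_def D_def using memI kl
      by (subst increment_cov) (auto simp: dyadic_Suc algebra_simps)
    then show ?thesis using abs_powr_second_difference_nonneg[of "2 * H" ?x ?h] H by simp
  qed
  have expand: "expectation (\<lambda>\<omega>. (\<Sum>l\<in>I. c l * D l \<omega>)\<^sup>2) = (\<Sum>k\<in>I. \<Sum>l\<in>I. c k * c l * G k l)" for c
  proof -
    have "(\<Sum>l\<in>I. c l * D l \<omega>)\<^sup>2 = (\<Sum>k\<in>I. \<Sum>l\<in>I. c k * c l * (D k \<omega> * D l \<omega>))" for \<omega>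
      by (simp add: power2_eq_square sum_product algebra_simps)
    then show ?thesis using int by (simp add: G_def)
  qed
  have "(\<lambda>\<omega>. riemann_sum f (\<lambda>t. W t \<omega>) T n p q) = (\<lambda>\<omega>. \<Sum>l\<in>I. f (dyadic T n l) * D l \<omega>)"
    by (simp add: riemann_sum_def I_def D_def)
  then have "expectation (\<lambda>\<omega>. (riemann_sum f (\<lambda>t. W t \<omega>) T n p q)\<^sup>2) =
     (\<Sum>k\<in>I. \<Sum>l\<in>I. f (dyadic T n k) * f (dyadic T n l) * G k l)"
    using expand[of "\<lambda>l. f (dyadic T n l)"] by (simp only: fun_eq_iff)
  also have "\<dots> \<le> (\<Sum>k\<in>I. \<Sum>l\<in>I. L\<^sup>2 * (1 * 1 * G k l))"
  proof (intro sum_mono)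
    fix k l assume kl: "k \<in> I" "l \<in> I"
    have "\<bar>f (dyadic T n k) * f (dyadic T n l)\<bar> \<le> L * L"
      unfolding abs_mult using f[OF memI(2)[OF kl(1)]] f[OF memI(2)[OF kl(2)]] by (intro mult_mono) auto
    then have "f (dyadic T n k) * f (dyadic T n l) \<le> L\<^sup>2" by (simp add: power2_eq_square)
    then show "f (dyadic T n k) * f (dyadic T n l) * G k l \<le> L\<^sup>2 * (1 * 1 * G k l)"
      using G0[OF kl] by (simp add: mult_right_mono)
  qed
  also have "\<dots> = L\<^sup>2 * expectation (\<lambda>\<omega>. (\<Sum>l\<in>I. 1 * D l \<omega>)\<^sup>2)"
    unfolding expand by (simp only: sum_distrib_left)
  also have "(\<lambda>\<omega>. (\<Sum>l\<in>I. 1 * D l \<omega>)\<^sup>2) =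
      (\<lambda>\<omega>. (W (dyadic T n q) \<omega> - W (dyadic T n p) \<omega>) * (W (dyadic T n q) \<omega> - W (dyadic T n p) \<omega>))"
    using pq unfolding I_def D_def
    by (simp add: power2_eq_square sum_Suc_diff'[of p q "\<lambda>l. W (dyadic T n l) _"])
  also have "expectation \<dots> = \<bar>dyadic T n q - dyadic T n p\<bar> powr (2 * H)"
    using mem pq H by (subst increment_cov) (auto simp: abs_minus_commute)
  also have "\<bar>dyadic T n q - dyadic T n p\<bar> = real (q - p) * (T / 2 ^ n)"
    using pq T by (simp add: dyadic_diff abs_mult of_nat_diff)
  finally show ?thesis .
qed

end

section \<open>Riemann--Stieltjes integrals as limits along dyadic grids\<close>

lemma dyadic_tagged_division:
  assumes T: "0 < T" and K: "1 \<le> K"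
  shows "(\<lambda>l. (dyadic T n l, {dyadic T n l..dyadic T n (Suc l)})) ` {..<K} tagged_division_of {0..dyadic T n K}"
  using K
proof (induction K rule: nat_induct_at_least)
  case base
  show ?case using tagged_division_of_self_real[of 0 0 "dyadic T n 1"] T by (simp add: dyadic_def lessThan_Suc)
next
  case (Suc K)
  have le: "0 \<le> dyadic T n K" "dyadic T n K \<le> dyadic T n (Suc K)" using T by (auto simp: dyadic_Suc) (simp add: dyadic_def)
  have "{(dyadic T n K, {dyadic T n K..dyadic T n (Suc K)})} tagged_division_of {dyadic T n K..dyadic T n (Suc K)}"
    using le by (intro tagged_division_of_self_real) simp
  from tagged_division_Un[OF Suc.IH this] show ?case
    using le by (simp add: lessThan_Suc ivl_disj_un_two_touch Un_commute[of _ "{_}"])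
qed

text \<open>Refining a dyadic grid keeps \<open>dyadic T n k\<close> a grid point: it is the point of index
  \<open>k * 2 ^ N\<close> on level \<open>n + N\<close>. The case \<open>k = 0\<close> is separate, because a tagged division of a
  single point is not empty.\<close>
lemma riemann_sum_tendsto:
  assumes T: "0 < T" and k: "0 < k" and I: "has_RS_integral f g 0 (dyadic T n k) I"
  shows "(\<lambda>N. riemann_sum f g T (n + N) 0 (k * 2 ^ N)) \<longlonglongrightarrow> I"
proof (rule LIMSEQ_I)
  fix e :: real assume e: "0 < e"
  obtain \<delta> where \<delta>: "\<delta> > 0" "\<And>D. D tagged_division_of {0..dyadic T n k} \<Longrightarrow> (\<forall>(\<xi>, K)\<in>D. diameter K < \<delta>) \<Longrightarrow>
        \<bar>(\<Sum>(\<xi>, K)\<in>D. f \<xi> * (g (Sup K) - g (Inf K))) - I\<bar> < e"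
    using I e unfolding has_RS_integral_def by meson
  have "(\<lambda>m. T / 2 ^ m) \<longlonglongrightarrow> 0" by (rule LIMSEQ_divide_realpow_zero) simp
  then have "eventually (\<lambda>m. T / 2 ^ m < \<delta>) sequentially" using \<delta>(1) by (rule order_tendstoD)
  then obtain N0 where N0: "\<And>m. m \<ge> N0 \<Longrightarrow> T / 2 ^ m < \<delta>" by (auto simp: eventually_sequentially)
  show "\<exists>no. \<forall>N\<ge>no. norm (riemann_sum f g T (n + N) 0 (k * 2 ^ N) - I) < e"
  proof (intro exI allI impI)
    fix N assume "N0 \<le> N"
    let ?x = "dyadic T (n + N)"
    let ?D = "(\<lambda>l. (?x l, {?x l..?x (Suc l)})) ` {..<k * 2 ^ N}"
    have le: "?x l \<le> ?x (Suc l)" for l using T by (simp add: dyadic_Suc)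
    have inj: "inj_on (\<lambda>l. (?x l, {?x l..?x (Suc l)})) {..<k * 2 ^ N}"
      using T by (auto simp: inj_on_def dyadic_def)
    have "1 \<le> k * 2 ^ N" using k by simp
    then have "?D tagged_division_of {0..dyadic T n k}"
      using dyadic_tagged_division[OF T, of "k * 2 ^ N" "n + N"] by (simp add: dyadic_refine)
    moreover have "\<forall>(\<xi>, K)\<in>?D. diameter K < \<delta>"
      using N0[of "n + N"] \<open>N0 \<le> N\<close> \<delta>(1) by (auto simp: dyadic_Suc)
    moreover have "(\<Sum>(\<xi>, K)\<in>?D. f \<xi> * (g (Sup K) - g (Inf K))) = riemann_sum f g T (n + N) 0 (k * 2 ^ N)"
      unfolding riemann_sum_def atLeast0LessThan by (subst sum.reindex[OF inj]) (simp add: le)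
    ultimately show "norm (riemann_sum f g T (n + N) 0 (k * 2 ^ N) - I) < e"
      using \<delta>(2)[of ?D] by simp
  qed
qed

lemma has_RS_integral_trivial:
  assumes "has_RS_integral f g a a I" shows "I = 0"
proof (rule ccontr)
  assume "I \<noteq> 0"
  then obtain \<delta> where \<delta>: "\<delta> > 0" "\<And>D. D tagged_division_of {a..a} \<Longrightarrow> (\<forall>(\<xi>, K)\<in>D. diameter K < \<delta>) \<Longrightarrow>
        \<bar>(\<Sum>(\<xi>, K)\<in>D. f \<xi> * (g (Sup K) - g (Inf K))) - I\<bar> < \<bar>I\<bar>"
    using assms zero_less_abs_iff[of I] unfolding has_RS_integral_def by meson
  have "{(a, {a..a})} tagged_division_of {a..a}" by (intro tagged_division_of_self_real) simp
  from \<delta>(2)[OF this] \<delta>(1) show False by simp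
qed

text \<open>The Riemann sums over \<open>[0, s]\<close> and \<open>[0, t]\<close> use the same grid, so their difference is the Riemann
  sum over \<open>[s, t]\<close>; this replaces additivity of the integral over intervals.\<close>
lemma riemann_sum_increment_tendsto:
  assumes T: "0 < T" and I: "has_RS_integral f g 0 (dyadic T n k) I"
    and I': "has_RS_integral f g 0 (dyadic T n (Suc k)) I'"
  shows "(\<lambda>N. riemann_sum f g T (n + N) (k * 2 ^ N) (Suc k * 2 ^ N)) \<longlonglongrightarrow> I' - I"
proof -
  have lim: "(\<lambda>N. riemann_sum f g T (n + N) 0 (k * 2 ^ N)) \<longlonglongrightarrow> I"
  proof (cases "k = 0")
    case True
    then show ?thesis using has_RS_integral_trivial[of f g 0 I] I by (simp add: riemann_sum_def)
  qed (use riemann_sum_tendsto[OF T _ I] in simp)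
  have "riemann_sum f g T (n + N) 0 (Suc k * 2 ^ N) - riemann_sum f g T (n + N) 0 (k * 2 ^ N) =
      riemann_sum f g T (n + N) (k * 2 ^ N) (Suc k * 2 ^ N)" for N
    unfolding riemann_sum_def
    using sum.atLeastLessThan_concat[of 0 "k * 2 ^ N" "Suc k * 2 ^ N"
        "\<lambda>l. f (dyadic T (n + N) l) * (g (dyadic T (n + N) (Suc l)) - g (dyadic T (n + N) l))"]
    by (simp del: mult_Suc)
  moreover have "(\<lambda>N. riemann_sum f g T (n + N) 0 (Suc k * 2 ^ N) - riemann_sum f g T (n + N) 0 (k * 2 ^ N)) \<longlonglongrightarrow> I' - I"
    by (intro tendsto_diff lim riemann_sum_tendsto[OF T _ I']) simp
  ultimately show ?thesis by simp
qed

section \<open>Chaining\<close>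

text \<open>A point of odd index on level \<open>n + 1\<close> is one step away from its left neighbour, which lies on
  level \<open>n\<close>.\<close>
lemma chaining_dyadic:
  fixes z :: "real \<Rightarrow> 'a :: real_normed_vector"
  assumes step: "\<And>n k. k < 2 ^ n \<Longrightarrow> norm (z (dyadic T n (Suc k)) - z (dyadic T n k)) \<le> a n"
  shows "k \<le> 2 ^ n \<Longrightarrow> norm (z (dyadic T n k) - z 0) \<le> (\<Sum>i\<le>n. a i)"
proof (induction n arbitrary: k)
  case 0
  then have "k = 0 \<or> k = 1" by auto
  moreover have "0 \<le> a 0" using order_trans[OF norm_ge_zero step[where n = 0 and k = 0]] by simp
  ultimately show ?case using step[where n = 0 and k = 0] by auto
next
  case (Suc n)
  have even: "norm (z (dyadic T (Suc n) (2 * l)) - z 0) \<le> (\<Sum>i\<le>n. a i)" if "l \<le> 2 ^ n" for l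
    using Suc.IH[OF that] dyadic_refine[of T n 1 l] by (simp add: mult.commute)
  have a0: "0 \<le> a (Suc n)" using order_trans[OF norm_ge_zero step[where n = "Suc n" and k = 0]] by simp
  show ?case
  proof (cases "even k")
    case True
    then obtain l where "k = 2 * l" by (rule evenE)
    then show ?thesis using even[of l] Suc.prems a0 by simp
  next
    case False
    then obtain l where k: "k = Suc (2 * l)" by (auto elim: oddE)
    have "norm (z (dyadic T (Suc n) k) - z 0) \<le>
       norm (z (dyadic T (Suc n) (Suc (2 * l))) - z (dyadic T (Suc n) (2 * l))) + norm (z (dyadic T (Suc n) (2 * l)) - z 0)"
      unfolding k by (rule order_trans[OF _ norm_triangle_ineq]) simp
    also have "\<dots> \<le> a (Suc n) + (\<Sum>i\<le>n. a i)"
      using k Suc.prems by (intro add_mono step even) auto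
    finally show ?thesis by simp
  qed
qed

text \<open>The value of \<open>\<Sum>n. (n + 1) / \<surd>2\<^sup>n\<close>.\<close>
definition chaining_const :: real where
  "chaining_const = 1 / (1 - 1 / sqrt 2)\<^sup>2"

lemma chaining_const_sum: "(\<Sum>i\<le>n. real (Suc i) * (1 / sqrt 2) ^ i) \<le> chaining_const"
proof -
  have s: "(\<lambda>i. real (Suc i) * (1 / sqrt 2) ^ i) sums chaining_const"
    unfolding chaining_const_def by (rule geometric_deriv_sums) simp
  show ?thesis unfolding sums_unique[OF s] lessThan_Suc_atMost[symmetric]
    by (rule sum_le_suminf) (use s in \<open>auto simp: sums_iff\<close>)
qed

lemma chaining_const_pos: "0 < chaining_const"
  using chaining_const_sum[of 0] by simp

text \<open>The hypothesis says that the increments on level \<open>n\<close> are at most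
  \<open>\<surd>(V / 2\<^sup>n) \<surd>(n ln 4 + ln y)\<close>. As \<open>n ln 4 + ln y \<le> (n + 1)\<^sup>2 (1 + ln y)\<close>, these bounds are
  summable with sum at most \<open>chaining_const * \<surd>(V (1 + ln y))\<close>.\<close>
lemma chaining_exp_bound:
  fixes z :: "real \<Rightarrow> 'a :: real_normed_vector"
  assumes T: "0 < T" and V: "0 < V" and y: "1 \<le> y" and z: "continuous_on {0..T} z"
    and step: "\<And>n k. k < 2 ^ n \<Longrightarrow>
      exp ((norm (z (dyadic T n (Suc k)) - z (dyadic T n k)))\<^sup>2 * 2 ^ n / V) \<le> 4 ^ n * y"
    and t: "t \<in> {0..T}"
  shows "(norm (z t - z 0))\<^sup>2 \<le> chaining_const\<^sup>2 * V * (1 + ln y)"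
proof -
  define R where "R = sqrt (V * (1 + ln y))"
  have R: "0 \<le> R" "R\<^sup>2 = V * (1 + ln y)" using V y by (auto simp: R_def)
  define a where "a n = R * (real (Suc n) * (1 / sqrt 2) ^ n)" for n
  have "norm (z (dyadic T n (Suc k)) - z (dyadic T n k)) \<le> a n" if k: "k < 2 ^ n" for n k
  proof -
    let ?x = "norm (z (dyadic T n (Suc k)) - z (dyadic T n k))"
    have "?x\<^sup>2 * 2 ^ n / V \<le> ln (4 ^ n * y)"
      using step[OF k] y by (subst ln_ge_iff) auto
    also have "\<dots> = real n * ln 4 + ln y" using y by (simp add: ln_mult ln_realpow)
    also have "\<dots> \<le> real n * 2 + ln y"
    proof -
      have "ln (4 :: real) = 2 * ln 2" using ln_realpow[of 2 2] by simp
      then have "ln (4 :: real) \<le> 2" using ln_2_less_1 by simp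
      then show ?thesis by (intro add_right_mono mult_left_mono) auto
    qed
    also have "\<dots> \<le> (real (Suc n))\<^sup>2 * (1 + ln y)"
    proof -
      have "1 * ln y \<le> (real (Suc n))\<^sup>2 * ln y" using y by (intro mult_right_mono) auto
      moreover have "real n * 2 \<le> (real (Suc n))\<^sup>2" by (simp add: power2_eq_square algebra_simps)
      ultimately show ?thesis by (simp add: algebra_simps)
    qed
    finally have "?x\<^sup>2 \<le> (real (Suc n))\<^sup>2 * (V * (1 + ln y)) / 2 ^ n"
      using V by (simp add: field_simps)
    also have "\<dots> = (a n)\<^sup>2"
      by (simp add: a_def power_mult_distrib R(2) power_divide flip: power_mult)
         (simp add: power_mult[of "sqrt 2" 2 n] mult.commute[of n 2])
    finally show ?thesis using R by (elim power2_le_imp_le) (auto simp: a_def)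
  qed
  then have chain: "norm (z (dyadic T n k) - z 0) \<le> (\<Sum>i\<le>n. a i)" if "k \<le> 2 ^ n" for n k
    using chaining_dyadic[of z T a k n] that by blast
  have "(\<Sum>i\<le>n. a i) \<le> R * chaining_const" for n
    unfolding a_def sum_distrib_left[symmetric] using R(1) by (intro mult_left_mono chaining_const_sum)
  then have "norm (z (dyadic T n k) - z 0) \<le> R * chaining_const" if "k \<le> 2 ^ n" for n k
    using chain[OF that] order_trans by blast
  moreover have "continuous_on {0..T} (\<lambda>t. norm (z t - z 0))" by (intro continuous_intros z)
  ultimately have "norm (z t - z 0) \<le> R * chaining_const"
    using le_of_dyadic_le[OF T _ _ t, of "\<lambda>t. norm (z t - z 0)"] by blast
  then have "(norm (z t - z 0))\<^sup>2 \<le> (R * chaining_const)\<^sup>2" by (intro power_mono) auto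
  then show ?thesis by (simp add: power_mult_distrib R(2) mult_ac)
qed

text \<open>\<open>Y - 1\<close> is the sum over all levels of \<open>4\<^sup>-\<^sup>n\<close> times the \<open>2\<^sup>n\<close> variables \<open>U n k\<close> of that level, so
  its mean is at most \<open>\<Sum>n. 2\<^sup>-\<^sup>n c = 2 c\<close>, and it dominates each summand. The measurable bounds \<open>U\<close>
  stand in for the square-exponentials of the increments, as the process \<open>z\<close> need not be measurable.\<close>
lemma (in prob_space) random_chaining:
  fixes z :: "'a \<Rightarrow> real \<Rightarrow> 'b :: real_normed_vector"
  assumes T: "0 < T" and V: "0 < V" and c: "0 \<le> c"
    and [measurable]: "\<And>n k. U n k \<in> borel_measurable M"
    and U: "\<And>n k. k < 2 ^ n \<Longrightarrow> (\<integral>\<^sup>+\<omega>. U n k \<omega> \<partial>M) \<le> ennreal c"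
    and AE: "AE \<omega> in M. continuous_on {0..T} (z \<omega>) \<and> (\<forall>n. \<forall>k<2 ^ n.
      ennreal (exp ((norm (z \<omega> (dyadic T n (Suc k)) - z \<omega> (dyadic T n k)))\<^sup>2 * 2 ^ n / V)) \<le> U n k \<omega>)"
  obtains Y where "Y \<in> borel_measurable M" "\<And>\<omega>. 1 \<le> Y \<omega>" "(\<integral>\<^sup>+\<omega>. ennreal (Y \<omega>) \<partial>M) \<le> ennreal (1 + 2 * c)"
    "AE \<omega> in M. \<forall>t\<in>{0..T}. (norm (z \<omega> t - z \<omega> 0))\<^sup>2 \<le> chaining_const\<^sup>2 * V * (1 + ln (Y \<omega>))"
proof -
  define S where "S \<omega> = (\<Sum>n. ennreal ((1 / 4) ^ n) * (\<Sum>k<2 ^ n. U n k \<omega>))" for \<omega>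
  have [measurable]: "S \<in> borel_measurable M" unfolding S_def by measurable
  have "(\<integral>\<^sup>+\<omega>. S \<omega> \<partial>M) = (\<Sum>n. ennreal ((1 / 4) ^ n) * (\<Sum>k<2 ^ n. \<integral>\<^sup>+\<omega>. U n k \<omega> \<partial>M))"
    unfolding S_def by (subst nn_integral_suminf; (simp add: nn_integral_cmult nn_integral_sum)?)
  also have "\<dots> \<le> (\<Sum>n. ennreal ((1 / 4) ^ n) * (\<Sum>k<(2::nat) ^ n. ennreal c))"
    using U by (intro suminf_le mult_left_mono sum_mono) auto
  also have "\<dots> = (\<Sum>n. ennreal ((1 / 2) ^ n * c))"
  proof (rule suminf_cong)
    fix n
    have "(\<Sum>k<(2::nat) ^ n. ennreal c) = ennreal (2 ^ n * c)"
      using c by (subst sum_ennreal) auto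
    moreover have "(1 / 4 :: real) ^ n * 2 ^ n = (1 / 2) ^ n" by (simp flip: power_mult_distrib)
    ultimately show "ennreal ((1 / 4) ^ n) * (\<Sum>k<(2::nat) ^ n. ennreal c) = ennreal ((1 / 2) ^ n * c)"
      using c by (simp add: mult.assoc[symmetric] flip: ennreal_mult)
  qed
  also have "\<dots> = ennreal (2 * c)"
  proof -
    have "(\<lambda>n. (1 / 2 :: real) ^ n * c) sums (1 / (1 - 1 / 2) * c)"
      by (intro sums_mult2 geometric_sums) simp
    then show ?thesis using c by (subst suminf_ennreal_eq[of _ "1 / (1 - 1 / 2) * c"]) auto
  qed
  finally have S: "(\<integral>\<^sup>+\<omega>. S \<omega> \<partial>M) \<le> ennreal (2 * c)" .
  then have "AE \<omega> in M. S \<omega> \<noteq> \<infinity>" by (intro nn_integral_PInf_AE) (auto simp: top_unique)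
  define Y where "Y \<omega> = 1 + enn2real (S \<omega>)" for \<omega>
  have Ym: "Y \<in> borel_measurable M" unfolding Y_def by measurable
  have Y1: "1 \<le> Y \<omega>" for \<omega> by (simp add: Y_def)
  have "(\<integral>\<^sup>+\<omega>. ennreal (Y \<omega>) \<partial>M) \<le> (\<integral>\<^sup>+\<omega>. 1 + S \<omega> \<partial>M)"
    by (intro nn_integral_mono) (simp add: Y_def ennreal_enn2real_if)
  also have "\<dots> \<le> 1 + ennreal (2 * c)"
    using S by (simp add: nn_integral_add emeasure_space_1)
  also have "\<dots> = ennreal (1 + 2 * c)" using c by simp
  finally have iY: "(\<integral>\<^sup>+\<omega>. ennreal (Y \<omega>) \<partial>M) \<le> ennreal (1 + 2 * c)" .
  have "AE \<omega> in M. \<forall>t\<in>{0..T}. (norm (z \<omega> t - z \<omega> 0))\<^sup>2 \<le> chaining_const\<^sup>2 * V * (1 + ln (Y \<omega>))"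
    using AE \<open>AE \<omega> in M. S \<omega> \<noteq> \<infinity>\<close>
  proof eventually_elim
    case (elim \<omega>)
    show ?case
    proof (intro ballI chaining_exp_bound[OF T V Y1])
      fix n k :: nat assume k: "k < 2 ^ n"
      let ?e = "exp ((norm (z \<omega> (dyadic T n (Suc k)) - z \<omega> (dyadic T n k)))\<^sup>2 * 2 ^ n / V)"
      have "ennreal ((1 / 4) ^ n * ?e) \<le> ennreal ((1 / 4) ^ n) * U n k \<omega>"
        using elim k by (auto simp: ennreal_mult intro!: mult_left_mono)
      also have "\<dots> \<le> ennreal ((1 / 4) ^ n) * (\<Sum>k<2 ^ n. U n k \<omega>)"
        using k by (intro mult_left_mono member_le_sum) auto
      also have "\<dots> \<le> S \<omega>"
        unfolding S_def using sum_le_suminf[OF summableI, of "{n}" "\<lambda>n. ennreal ((1 / 4) ^ n) * (\<Sum>k<2 ^ n. U n k \<omega>)"] by simp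
      also have "S \<omega> = ennreal (enn2real (S \<omega>))" using elim by (simp add: less_top)
      finally have "(1 / 4) ^ n * ?e \<le> enn2real (S \<omega>)" by (subst (asm) ennreal_le_iff) auto
      then have "(1 / 4) ^ n * ?e \<le> Y \<omega>" by (simp add: Y_def)
      then show "?e \<le> 4 ^ n * Y \<omega>" by (simp add: power_divide field_simps)
    qed (use elim in auto)
  qed
  with Ym iY Y1 show thesis by (intro that[of Y])
qed

section \<open>Lipschitz dependence of the solution on the noise\<close>

text \<open>The suprema in the norm are taken over bounded sets, so that they are genuine upper bounds; the
  seminorm is nonnegative as \<open>0 < T\<close> makes its index set nonempty.\<close>
lemma holder_space_norm_bound:
  assumes f: "f \<in> holder_space lam T" and lam: "0 \<le> lam" and T: "0 < T" and t: "t \<in> {0..T}"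
  shows "norm (f t) \<le> holder_norm lam T f"
proof -
  obtain C where C: "\<And>r s. r \<in> {0..T} \<Longrightarrow> s \<in> {0..T} \<Longrightarrow> norm (f s - f r) \<le> C * \<bar>s - r\<bar> powr lam"
    using f unfolding holder_space_def by blast
  have "norm (f r) \<le> norm (f 0) + \<bar>C\<bar> * T powr lam" if r: "r \<in> {0..T}" for r
  proof -
    have "norm (f r) \<le> norm (f 0) + norm (f r - f 0)" by (rule norm_triangle_sub)
    also have "norm (f r - f 0) \<le> C * \<bar>r - 0\<bar> powr lam" using C[of 0 r] r T by auto
    also have "\<dots> \<le> \<bar>C\<bar> * T powr lam"
      using r lam by (intro mult_mono powr_mono2) auto
    finally show ?thesis by simp
  qed
  then have "bdd_above ((\<lambda>r. norm (f r)) ` {0..T})" by (intro bdd_aboveI2)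
  then have 1: "norm (f t) \<le> sup_norm T f"
    unfolding sup_norm_def using t by (rule cSUP_upper[rotated])
  let ?I = "{(r, s). 0 \<le> r \<and> r < s \<and> s \<le> T}"
  let ?q = "\<lambda>(r, s). norm (f s - f r) / \<bar>s - r\<bar> powr lam"
  have "?q p \<le> C" if "p \<in> ?I" for p
    using that C[of "fst p" "snd p"] by (auto simp: divide_simps)
  then have "bdd_above (?q ` ?I)" by (intro bdd_aboveI2)
  then have "?q (0, T) \<le> holder_seminorm lam T f"
    unfolding holder_seminorm_def using T by (intro cSUP_upper) auto
  moreover have "0 \<le> ?q (0, T)" by simp
  ultimately have "0 \<le> holder_seminorm lam T f" by linarith
  with 1 show ?thesis by (simp add: holder_norm_def)
qed

lemma restrict_in_paths: "continuous_on {0..T} X \<Longrightarrow> restrict X {0..T} \<in> paths T"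
  using continuous_on_eq[of "{0..T}" X "restrict X {0..T}"] by (simp add: paths_def)

text \<open>The distance \<open>D\<close> of the two paths satisfies \<open>D \<le> r + L T D \<le> r + D / 2\<close>.\<close>
lemma solution_map_lipschitz:
  fixes X X' :: "real \<Rightarrow> 'a :: euclidean_space"
  assumes T: "0 < T" and X: "continuous_on {0..T} X" "continuous_on {0..T} X'"
    and b: "L-lipschitz_on UNIV b" and LT: "L * T \<le> 1 / 2"
    and r: "\<And>t. t \<in> {0..T} \<Longrightarrow>
      norm ((X t - integral {0..t} (\<lambda>s. b (X s))) - (X' t - integral {0..t} (\<lambda>s. b (X' s)))) \<le> r"
  shows "d_infty T (restrict X {0..T}) (restrict X' {0..T}) \<le> 2 * r"
proof -
  let ?D = "d_infty T (restrict X {0..T}) (restrict X' {0..T})"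
  have p: "restrict X {0..T} \<in> paths T" "restrict X' {0..T} \<in> paths T"
    using X by (auto intro: restrict_in_paths)
  have D: "norm (X t - X' t) \<le> ?D" if "t \<in> {0..T}" for t
    using norm_le_d_infty[OF p that] that by simp
  have D0: "0 \<le> ?D" using order_trans[OF norm_ge_zero D[of 0]] T by simp
  have L0: "0 \<le> L" using b by (rule lipschitz_on_nonneg)
  have cb: "continuous_on UNIV b" using b by (rule lipschitz_on_continuous_on)
  have "?D \<le> r + ?D / 2"
  proof (rule d_infty_le)
    fix t assume t: "t \<in> {0..T}"
    have c: "continuous_on {0..t} (\<lambda>s. b (X s))" "continuous_on {0..t} (\<lambda>s. b (X' s))"
      by (rule continuous_on_compose2[OF cb], rule continuous_on_subset[OF X(1)] continuous_on_subset[OF X(2)], use t in auto)+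
    have "norm (integral {0..t} (\<lambda>s. b (X s) - b (X' s))) \<le> L * ?D * (t - 0)"
    proof (rule integral_bound)
      fix s assume s: "s \<in> {0..t}"
      have "norm (b (X s) - b (X' s)) \<le> L * norm (X s - X' s)"
        using lipschitz_onD[OF b, of "X s" "X' s"] by (simp add: dist_norm)
      also have "\<dots> \<le> L * ?D" using s t by (intro mult_left_mono D L0) auto
      finally show "norm (b (X s) - b (X' s)) \<le> L * ?D" .
    qed (use t c in \<open>auto intro!: continuous_intros\<close>)
    also have "\<dots> \<le> L * ?D * T" using t L0 D0 by (intro mult_left_mono) auto
    also have "\<dots> \<le> 1 / 2 * ?D" using mult_right_mono[OF LT D0] by (simp add: mult_ac)
    finally have i: "norm (integral {0..t} (\<lambda>s. b (X s) - b (X' s))) \<le> ?D / 2" by simp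
    have "integral {0..t} (\<lambda>s. b (X s) - b (X' s)) = integral {0..t} (\<lambda>s. b (X s)) - integral {0..t} (\<lambda>s. b (X' s))"
      using c by (intro Henstock_Kurzweil_Integration.integral_diff integrable_continuous_interval)
    then have "X t - X' t = ((X t - integral {0..t} (\<lambda>s. b (X s))) - (X' t - integral {0..t} (\<lambda>s. b (X' s)))) +
       integral {0..t} (\<lambda>s. b (X s) - b (X' s))" by simp
    also have "norm \<dots> \<le> r + ?D / 2" by (rule norm_triangle_le) (intro add_mono r t i)
    finally show "norm (restrict X {0..T} t - restrict X' {0..T} t) \<le> r + ?D / 2"
      unfolding restrict_apply'[OF t] .
  qed (use T p in auto)
  then show ?thesis by simp
qed

text \<open>The largest of the \<open>\<bar>a\<^sub>i\<bar>\<close> is at least the average. This reduces vector-valued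
  noise to the scalar integrals.\<close>
lemma exp_square_of_sum_le:
  fixes a :: "'i \<Rightarrow> real"
  assumes I: "finite I" "I \<noteq> {}" and q: "0 < q" and x: "0 \<le> x" "x \<le> (\<Sum>i\<in>I. \<bar>a i\<bar>)"
  shows "exp (x\<^sup>2 / ((real (card I))\<^sup>2 * q)) \<le> (\<Sum>i\<in>I. exp ((a i)\<^sup>2 / q))"
proof -
  let ?m = "Max ((\<lambda>i. \<bar>a i\<bar>) ` I)"
  have "?m \<in> (\<lambda>i. \<bar>a i\<bar>) ` I" using I by (intro Max_in) auto
  then obtain p where p: "p \<in> I" "?m = \<bar>a p\<bar>" by auto
  have "\<bar>a i\<bar> \<le> \<bar>a p\<bar>" if "i \<in> I" for i
    using Max_ge[of "(\<lambda>i. \<bar>a i\<bar>) ` I" "\<bar>a i\<bar>"] that I p by auto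
  then have "x \<le> real (card I) * \<bar>a p\<bar>"
    using sum_bounded_above[of I "\<lambda>i. \<bar>a i\<bar>" "\<bar>a p\<bar>"] x by auto
  then have "x\<^sup>2 \<le> (real (card I) * \<bar>a p\<bar>)\<^sup>2" using x by (intro power_mono)
  then have "x\<^sup>2 \<le> (real (card I))\<^sup>2 * (a p)\<^sup>2" by (simp add: power_mult_distrib)
  moreover have "0 < card I" using I by (simp add: card_gt_0_iff)
  ultimately have "x\<^sup>2 / ((real (card I))\<^sup>2 * q) \<le> (a p)\<^sup>2 / q"
    using q by (simp add: divide_simps mult_ac)
  then have "exp (x\<^sup>2 / ((real (card I))\<^sup>2 * q)) \<le> exp ((a p)\<^sup>2 / q)" by simp
  also have "\<dots> \<le> (\<Sum>i\<in>I. exp ((a i)\<^sup>2 / q))" using p I by (intro member_le_sum) auto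
  finally show ?thesis .
qed

section \<open>Square-exponential moments of increments of the noise\<close>

text \<open>A measurable version of \<open>exp ((\<integral> f dW)\<^sup>2 / (4 v))\<close> for the integral over the \<open>k\<close>-th cell of level
  \<open>n\<close>: the lower limit exists everywhere, and equals this value wherever the integrals exist. The value 0
  for \<open>k \<ge> 2 ^ n\<close> belongs to cells outside \<open>[0, T]\<close>, where nothing is known about \<open>W\<close>.\<close>
definition increment_exp_moment ::
  "(real \<Rightarrow> real) \<Rightarrow> (real \<Rightarrow> 'w \<Rightarrow> real) \<Rightarrow> real \<Rightarrow> real \<Rightarrow> nat \<Rightarrow> nat \<Rightarrow> 'w \<Rightarrow> ennreal" where
  "increment_exp_moment f W T v n k \<omega> =
     (if k < 2 ^ n then liminf (\<lambda>N. ennreal (exp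
        ((riemann_sum f (\<lambda>t. W t \<omega>) T (n + N) (k * 2 ^ N) (Suc k * 2 ^ N))\<^sup>2 / (4 * v)))) else 0)"

lemma increment_exp_moment_eq:
  assumes T: "0 < T" and k: "k < 2 ^ n" and I: "has_RS_integral f (\<lambda>t. W t \<omega>) 0 (dyadic T n k) I"
    and I': "has_RS_integral f (\<lambda>t. W t \<omega>) 0 (dyadic T n (Suc k)) I'" and v: "0 < v"
  shows "increment_exp_moment f W T v n k \<omega> = ennreal (exp ((I' - I)\<^sup>2 / (4 * v)))"
proof -
  have "(\<lambda>N. ennreal (exp ((riemann_sum f (\<lambda>t. W t \<omega>) T (n + N) (k * 2 ^ N) (Suc k * 2 ^ N))\<^sup>2 / (4 * v))))
      \<longlonglongrightarrow> ennreal (exp ((I' - I)\<^sup>2 / (4 * v)))"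
    using v by (intro tendsto_ennrealI tendsto_intros riemann_sum_increment_tendsto[OF T I I']) auto
  then show ?thesis
    using k unfolding increment_exp_moment_def by (simp add: lim_imp_Liminf)
qed

context scalar_fbm
begin

lemma measurable_riemann_sum:
  "q \<le> 2 ^ n \<Longrightarrow> (\<lambda>\<omega>. riemann_sum f (\<lambda>t. W t \<omega>) T n p q) \<in> borel_measurable M"
  by (rule borel_measurable_integrable[OF gaussian_rv_integrable(1)[OF riemann_sum_gaussian(1)]])

lemma increment_index_le: "k < 2 ^ n \<Longrightarrow> Suc k * 2 ^ N \<le> 2 ^ (n + N)"
  unfolding power_add by (intro mult_right_mono) auto

lemma measurable_increment_exp_moment [measurable]:
  "increment_exp_moment f W T v n k \<in> borel_measurable M"
proof (cases "k < 2 ^ n")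
  case True
  have [measurable]: "(\<lambda>\<omega>. riemann_sum f (\<lambda>t. W t \<omega>) T (n + N) (k * 2 ^ N) (Suc k * 2 ^ N)) \<in> borel_measurable M" for N
    by (intro measurable_riemann_sum increment_index_le True)
  show ?thesis unfolding increment_exp_moment_def[abs_def] by (simp only: True if_True) measurable
qed (simp add: increment_exp_moment_def[abs_def])

text \<open>Fatou's lemma reduces the claim to the Riemann sums, whose variance on a cell is at most \<open>L\<^sup>2 (T / 2\<^sup>n)\<^sup>2\<^sup>H\<close>, and \<open>2\<^sup>-\<^sup>2\<^sup>n\<^sup>H \<le> 2\<^sup>-\<^sup>n\<close> makes the bound uniform in \<open>H\<close>.\<close>
lemma increment_exp_moment_integral:
  assumes k: "k < 2 ^ n" and f: "\<And>t. t \<in> {0..T} \<Longrightarrow> \<bar>f t\<bar> \<le> L" and A: "L * T powr H \<le> A" "0 < A" and L: "0 \<le> L"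
  shows "(\<integral>\<^sup>+\<omega>. increment_exp_moment f W T (A\<^sup>2 / 2 ^ n) n k \<omega> \<partial>M) \<le> ennreal (sqrt 2)"
proof -
  let ?v = "A\<^sup>2 / 2 ^ n"
  let ?S = "\<lambda>N \<omega>. riemann_sum f (\<lambda>t. W t \<omega>) T (n + N) (k * 2 ^ N) (Suc k * 2 ^ N)"
  have v: "0 < ?v" using A by simp
  have bd: "(\<integral>\<^sup>+\<omega>. ennreal (exp ((?S N \<omega>)\<^sup>2 / (4 * ?v))) \<partial>M) \<le> ennreal (sqrt 2)" for N
  proof (rule gaussian_exp_square)
    have "expectation (\<lambda>\<omega>. (?S N \<omega>)\<^sup>2) \<le>
        L\<^sup>2 * (real (Suc k * 2 ^ N - k * 2 ^ N) * (T / 2 ^ (n + N))) powr (2 * H)"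
      using increment_index_le[OF k] f by (intro riemann_sum_second_moment) auto
    also have "real (Suc k * 2 ^ N - k * 2 ^ N) * (T / 2 ^ (n + N)) = T / 2 ^ n"
      by (simp add: power_add)
    also have "L\<^sup>2 * (T / 2 ^ n) powr (2 * H) \<le> L\<^sup>2 * (T powr (2 * H) / 2 ^ n)"
    proof (intro mult_left_mono)
      have "(2 ^ n :: real) powr 1 \<le> (2 ^ n) powr (2 * H)" using H by (intro powr_mono) auto
      then show "(T / 2 ^ n) powr (2 * H) \<le> T powr (2 * H) / 2 ^ n"
        using T by (simp add: powr_divide) (intro divide_left_mono, auto)
    qed simp
    also have "\<dots> = (L * T powr H)\<^sup>2 / 2 ^ n"
      using T by (simp add: power_mult_distrib powr_power mult.commute)
    also have "\<dots> \<le> ?v" using A L by (intro divide_right_mono power_mono) auto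
    finally show "expectation (\<lambda>\<omega>. (?S N \<omega>)\<^sup>2) \<le> ?v" .
  qed (use v riemann_sum_gaussian[OF increment_index_le[OF k]] in auto)
  have "(\<integral>\<^sup>+\<omega>. increment_exp_moment f W T ?v n k \<omega> \<partial>M) =
      (\<integral>\<^sup>+\<omega>. liminf (\<lambda>N. ennreal (exp ((?S N \<omega>)\<^sup>2 / (4 * ?v)))) \<partial>M)"
    using k by (simp add: increment_exp_moment_def)
  also have "\<dots> \<le> liminf (\<lambda>N. \<integral>\<^sup>+\<omega>. ennreal (exp ((?S N \<omega>)\<^sup>2 / (4 * ?v))) \<partial>M)"
  proof (rule nn_integral_liminf)
    fix N
    have [measurable]: "?S N \<in> borel_measurable M" by (intro measurable_riemann_sum increment_index_le k)
    show "(\<lambda>\<omega>. ennreal (exp ((?S N \<omega>)\<^sup>2 / (4 * ?v)))) \<in> borel_measurable M" by measurable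
  qed
  also have "\<dots> \<le> liminf (\<lambda>N. ennreal (sqrt 2))"
    by (intro Liminf_mono always_eventually allI bd)
  also have "\<dots> = ennreal (sqrt 2)" by (simp add: Liminf_const)
  finally show ?thesis .
qed

end

section \<open>The transportation inequality for the solution\<close>

lemma (in prob_space) nn_integral_le_imp_ex_le:
  assumes Y: "(\<integral>\<^sup>+\<omega>. ennreal (Y \<omega>) \<partial>M) \<le> ennreal c" and c: "0 \<le> c" "c < c'" and P: "AE \<omega> in M. P \<omega>"
  shows "\<exists>\<omega>\<in>space M. P \<omega> \<and> Y \<omega> \<le> c'"
proof (rule ccontr)
  assume "\<not> ?thesis"
  then have large: "c' \<le> Y \<omega>" if "\<omega> \<in> space M" "P \<omega>" for \<omega>
    using that by (meson linear)
  have "AE \<omega> in M. c' \<le> Y \<omega>"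
    using P AE_space by eventually_elim (rule large)
  then have "(\<integral>\<^sup>+\<omega>. ennreal c' \<partial>M) \<le> (\<integral>\<^sup>+\<omega>. ennreal (Y \<omega>) \<partial>M)"
    by (intro nn_integral_mono_AE) (auto elim: eventually_mono intro: ennreal_leI)
  then have "ennreal c' \<le> ennreal c" using Y by (simp add: emeasure_space_1)
  then show False using c by simp
qed

lemma fbm_component:
  fixes B :: "real \<Rightarrow> 'w \<Rightarrow> real ^ 'm"
  assumes "prob_space M" "1 / 2 \<le> H" "0 < T" "fractional_brownian_motion M H T B"
  shows "scalar_fbm M H T (\<lambda>t \<omega>. B t \<omega> $ j)"
  using assms by (simp add: scalar_fbm_def scalar_fbm_axioms_def fractional_brownian_motion_def)

text \<open>What remains of a solution path after removing the drift: the starting point plus the stochastic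
  integral.\<close>
definition driving_path ::
  "('a :: euclidean_space \<Rightarrow> 'a) \<Rightarrow> (real \<Rightarrow> 'a) \<Rightarrow> real \<Rightarrow> 'a" where
  "driving_path b X t = X t - integral {0..t} (\<lambda>s. b (X s))"

lemma driving_path_continuous:
  assumes b: "continuous_on UNIV b" and X: "continuous_on {0..T} X"
  shows "continuous_on {0..T} (driving_path b X)"
proof -
  have "continuous_on {0..T} (\<lambda>s. b (X s))" by (rule continuous_on_compose2[OF b X]) simp
  then show ?thesis
    unfolding driving_path_def
    by (intro continuous_intros X indefinite_integral_continuous_1 integrable_continuous_interval)
qed

lemma driving_path_increment:
  fixes X :: "real \<Rightarrow> real ^ 'd" and B :: "real \<Rightarrow> real ^ 'm" and \<sigma> :: "real \<Rightarrow> real ^ 'm ^ 'd" and b :: "real ^ 'd \<Rightarrow> real ^ 'd"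
  assumes b: "continuous_on UNIV b" and X: "continuous_on {0..T} X"
    and eq: "\<forall>t\<in>{0..T}. \<forall>i. \<exists>I. (\<forall>j. has_RS_integral (\<lambda>s. \<sigma> s $ i $ j) (\<lambda>s. B s $ j) 0 t (I j)) \<and>
        X t $ i = x $ i + integral {0..t} (\<lambda>s. b (X s) $ i) + (\<Sum>j\<in>UNIV. I j)"
  obtains J where
    "\<And>t i j. t \<in> {0..T} \<Longrightarrow> has_RS_integral (\<lambda>s. \<sigma> s $ i $ j) (\<lambda>s. B s $ j) 0 t (J t (i, j))"
    "\<And>t i. t \<in> {0..T} \<Longrightarrow> driving_path b X t $ i = x $ i + (\<Sum>j\<in>UNIV. J t (i, j))"
    "\<And>s t. s \<in> {0..T} \<Longrightarrow> t \<in> {0..T} \<Longrightarrow>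
       norm (driving_path b X t - driving_path b X s) \<le> (\<Sum>p\<in>UNIV. \<bar>J t p - J s p\<bar>)"
proof -
  let ?z = "driving_path b X"
  define J0 where "J0 t i = (SOME I. (\<forall>j. has_RS_integral (\<lambda>s. \<sigma> s $ i $ j) (\<lambda>s. B s $ j) 0 t (I j)) \<and>
        X t $ i = x $ i + integral {0..t} (\<lambda>s. b (X s) $ i) + (\<Sum>j\<in>UNIV. I j))" for t i
  have J0: "has_RS_integral (\<lambda>s. \<sigma> s $ i $ j) (\<lambda>s. B s $ j) 0 t (J0 t i j)"
      "X t $ i = x $ i + integral {0..t} (\<lambda>s. b (X s) $ i) + (\<Sum>j\<in>UNIV. J0 t i j)" if "t \<in> {0..T}" for t i j
    using someI_ex[OF eq[rule_format, OF that, of i]] unfolding J0_def by auto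
  define J where "J t p = J0 t (fst p) (snd p)" for t p
  have z: "?z t $ i = x $ i + (\<Sum>j\<in>UNIV. J t (i, j))" if t: "t \<in> {0..T}" for t i
  proof -
    have "continuous_on {0..t} (\<lambda>s. b (X s))"
      by (rule continuous_on_compose2[OF b], rule continuous_on_subset[OF X]) (use t in auto)
    then have "(\<lambda>s. b (X s)) integrable_on {0..t}" by (rule integrable_continuous_interval)
    then show ?thesis using J0(2)[OF t, of i] by (simp add: driving_path_def J_def)
  qed
  show thesis
  proof (rule that[of J])
    fix s t assume st: "s \<in> {0..T}" "t \<in> {0..T}"
    have "norm (?z t - ?z s) \<le> (\<Sum>i\<in>UNIV. \<bar>(?z t - ?z s) $ i\<bar>)" by (rule norm_le_l1_cart)
    also have "\<dots> = (\<Sum>i\<in>UNIV. \<bar>\<Sum>j\<in>UNIV. J t (i, j) - J s (i, j)\<bar>)"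
      using st by (simp add: z sum_subtractf)
    also have "\<dots> \<le> (\<Sum>i\<in>UNIV. \<Sum>j\<in>UNIV. \<bar>J t (i, j) - J s (i, j)\<bar>)"
      by (intro sum_mono sum_abs)
    also have "\<dots> = (\<Sum>p\<in>UNIV. \<bar>J t p - J s p\<bar>)"
      by (simp add: sum.cartesian_product split_beta UNIV_Times_UNIV)
    finally show "norm (?z t - ?z s) \<le> (\<Sum>p\<in>UNIV. \<bar>J t p - J s p\<bar>)" .
  qed (use J0(1) z in \<open>auto simp: J_def\<close>)
qed

text \<open>Chaining for the driving path. Its dyadic increments are bounded by sums of \<open>d m\<close> scalar integrals,
  which is where the factor \<open>P\<close> and the powers of it come from.\<close>
theorem sde_exponential_bound:
  fixes X :: "real \<Rightarrow> 'w \<Rightarrow> real ^ 'd" and \<sigma> :: "real \<Rightarrow> real ^ 'm ^ 'd" and b :: "real ^ 'd \<Rightarrow> real ^ 'd"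
  assumes M: "prob_space M" and H: "1 / 2 \<le> H" and T: "0 < T" and b: "continuous_on UNIV b"
    and B: "fractional_brownian_motion M H T B" and X: "sde_solution M F T x b \<sigma> B X"
    and \<sigma>: "\<And>t. t \<in> {0..T} \<Longrightarrow> norm (\<sigma> t) \<le> L" and L: "0 \<le> L" and A: "L * T powr H \<le> A" "0 < A"
  defines "P \<equiv> real CARD('d \<times> 'm)"
  obtains Y where "Y \<in> borel_measurable M" "\<And>\<omega>. 1 \<le> Y \<omega>"
    "(\<integral>\<^sup>+\<omega>. ennreal (Y \<omega>) \<partial>M) \<le> ennreal (1 + 2 * (P * sqrt 2))"
    "AE \<omega> in M. \<forall>t\<in>{0..T}. (norm (driving_path b (\<lambda>t. X t \<omega>) t - x))\<^sup>2 \<le>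
        chaining_const\<^sup>2 * (4 * P\<^sup>2 * A\<^sup>2) * (1 + ln (Y \<omega>))"
proof -
  interpret prob_space M by fact
  have fbm: "scalar_fbm M H T (\<lambda>t \<omega>. B t \<omega> $ j)" for j using M H T B by (rule fbm_component)
  have P: "0 < P" by (simp add: P_def)
  define u where "u p n k = increment_exp_moment (\<lambda>s. \<sigma> s $ fst p $ snd p) (\<lambda>t \<omega>. B t \<omega> $ snd p) T (A\<^sup>2 / 2 ^ n) n k" 
    for p :: "'d \<times> 'm" and n k
  have [measurable]: "u p n k \<in> borel_measurable M" for p n k
    unfolding u_def by (rule scalar_fbm.measurable_increment_exp_moment[OF fbm])
  define U where "U n k \<omega> = (\<Sum>p\<in>UNIV. u p n k \<omega>)" for n k \<omega>
  have [measurable]: "U n k \<in> borel_measurable M" for n k unfolding U_def by measurable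
  have \<sigma>': "\<bar>\<sigma> t $ i $ j\<bar> \<le> L" if "t \<in> {0..T}" for t i j
    using component_le_norm_cart[of "\<sigma> t $ i" j] Finite_Cartesian_Product.norm_nth_le[where x = "\<sigma> t" and i = i] \<sigma>[OF that] by linarith
  have iU: "(\<integral>\<^sup>+\<omega>. U n k \<omega> \<partial>M) \<le> ennreal (P * sqrt 2)" if k: "k < 2 ^ n" for n k
  proof -
    have "(\<integral>\<^sup>+\<omega>. U n k \<omega> \<partial>M) = (\<Sum>p\<in>UNIV. \<integral>\<^sup>+\<omega>. u p n k \<omega> \<partial>M)"
      unfolding U_def by (intro nn_integral_sum) auto
    also have "\<dots> \<le> (\<Sum>p\<in>(UNIV :: ('d \<times> 'm) set). ennreal (sqrt 2))"
      unfolding u_def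
      by (intro sum_mono scalar_fbm.increment_exp_moment_integral[OF fbm k _ A L] \<sigma>')
    also have "\<dots> = ennreal (P * sqrt 2)" by (subst sum_ennreal) (auto simp: P_def)
    finally show ?thesis .
  qed
  define z where "z \<omega> = driving_path b (\<lambda>t. X t \<omega>)" for \<omega>
  have AE: "AE \<omega> in M. (continuous_on {0..T} (z \<omega>) \<and> (\<forall>n. \<forall>k<2 ^ n.
      ennreal (exp ((norm (z \<omega> (dyadic T n (Suc k)) - z \<omega> (dyadic T n k)))\<^sup>2 * 2 ^ n / (4 * P\<^sup>2 * A\<^sup>2))) \<le> U n k \<omega>))
      \<and> z \<omega> 0 = x"
  proof -
    have eq: "AE \<omega> in M. \<forall>t\<in>{0..T}. \<forall>i. \<exists>I. (\<forall>j. has_RS_integral (\<lambda>s. \<sigma> s $ i $ j) (\<lambda>s. B s \<omega> $ j) 0 t (I j)) \<and>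
        X t \<omega> $ i = x $ i + integral {0..t} (\<lambda>s. b (X s \<omega>) $ i) + (\<Sum>j\<in>UNIV. I j)"
      and cX: "\<And>\<omega>. \<omega> \<in> space M \<Longrightarrow> continuous_on {0..T} (\<lambda>t. X t \<omega>)"
      using X unfolding sde_solution_def by auto
    show ?thesis using eq AE_space
    proof eventually_elim
      case (elim \<omega>)
      note c = cX[OF elim(2)]
      obtain J where J: 
        "\<And>t i j. t \<in> {0..T} \<Longrightarrow> has_RS_integral (\<lambda>s. \<sigma> s $ i $ j) (\<lambda>s. B s \<omega> $ j) 0 t (J t (i, j))"
        "\<And>t i. t \<in> {0..T} \<Longrightarrow> z \<omega> t $ i = x $ i + (\<Sum>j\<in>UNIV. J t (i, j))"
        "\<And>s t. s \<in> {0..T} \<Longrightarrow> t \<in> {0..T} \<Longrightarrow> norm (z \<omega> t - z \<omega> s) \<le> (\<Sum>p\<in>UNIV. \<bar>J t p - J s p\<bar>)"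
        unfolding z_def by (rule driving_path_increment[OF b c elim(1)]) blast
      have T0: "0 \<in> {0..T}" using T by simp
      have "J 0 (i, j) = 0" for i j by (rule has_RS_integral_trivial[OF J(1)[OF T0]])
      then have "z \<omega> 0 = x" using J(2)[OF T0] by (simp add: vec_eq_iff)
      moreover have "ennreal (exp ((norm (z \<omega> (dyadic T n (Suc k)) - z \<omega> (dyadic T n k)))\<^sup>2 * 2 ^ n / (4 * P\<^sup>2 * A\<^sup>2))) \<le> U n k \<omega>"
        if k: "k < 2 ^ n" for n k
      proof -
        let ?s = "dyadic T n k" and ?t = "dyadic T n (Suc k)"
        have st: "?s \<in> {0..T}" "?t \<in> {0..T}" using k T by (auto intro!: dyadic_mem simp del: atLeastAtMost_iff)
        have v: "0 < A\<^sup>2 / 2 ^ n" using A by simp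
        have u: "u p n k \<omega> = ennreal (exp ((J ?t p - J ?s p)\<^sup>2 / (4 * (A\<^sup>2 / 2 ^ n))))" for p
          unfolding u_def using J(1)[OF st(1), of "fst p" "snd p"] J(1)[OF st(2), of "fst p" "snd p"]
          by (intro increment_exp_moment_eq[OF T k _ _ v]) auto
        have "(norm (z \<omega> ?t - z \<omega> ?s))\<^sup>2 * 2 ^ n / (4 * P\<^sup>2 * A\<^sup>2) = (norm (z \<omega> ?t - z \<omega> ?s))\<^sup>2 / (P\<^sup>2 * (4 * (A\<^sup>2 / 2 ^ n)))"
          using A P by (simp add: field_simps)
        also have "exp \<dots> \<le> (\<Sum>p\<in>UNIV. exp ((J ?t p - J ?s p)\<^sup>2 / (4 * (A\<^sup>2 / 2 ^ n))))"
          unfolding P_def using A by (intro exp_square_of_sum_le J(3) st) auto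
        finally show ?thesis
          unfolding U_def u by (subst sum_ennreal) (auto intro: ennreal_leI)
      qed
      ultimately show ?case using driving_path_continuous[OF b c] by (simp add: z_def)
    qed
  qed
  then have AE1: "AE \<omega> in M. continuous_on {0..T} (z \<omega>) \<and> (\<forall>n. \<forall>k<2 ^ n.
      ennreal (exp ((norm (z \<omega> (dyadic T n (Suc k)) - z \<omega> (dyadic T n k)))\<^sup>2 * 2 ^ n / (4 * P\<^sup>2 * A\<^sup>2))) \<le> U n k \<omega>)"
    by eventually_elim blast
  have V: "0 < 4 * P\<^sup>2 * A\<^sup>2" using P A by simp
  have c0: "0 \<le> P * sqrt 2" using P by simp
  obtain Y where Y: "Y \<in> borel_measurable M" "\<And>\<omega>. 1 \<le> Y \<omega>"
      "(\<integral>\<^sup>+\<omega>. ennreal (Y \<omega>) \<partial>M) \<le> ennreal (1 + 2 * (P * sqrt 2))"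
    and bd: "AE \<omega> in M. \<forall>t\<in>{0..T}. (norm (z \<omega> t - z \<omega> 0))\<^sup>2 \<le> chaining_const\<^sup>2 * (4 * P\<^sup>2 * A\<^sup>2) * (1 + ln (Y \<omega>))"
    by (rule random_chaining[OF T V c0 _ iU AE1]) auto
  have "AE \<omega> in M. \<forall>t\<in>{0..T}. (norm (z \<omega> t - x))\<^sup>2 \<le> chaining_const\<^sup>2 * (4 * P\<^sup>2 * A\<^sup>2) * (1 + ln (Y \<omega>))"
    using bd AE by eventually_elim simp
  with Y show thesis by (intro that[of Y]) (auto simp: z_def)
qed

text \<open>The constant \<open>C\<close> of the square-exponential moment of the distance to the anchor path, for \<open>P = d m\<close>:
  \<open>1 + 2 P \<surd>2\<close> bounds the mean of \<open>Y\<close>, and \<open>2 + 2 P \<surd>2\<close> its value at the anchor.\<close>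
definition moment_bound :: "real \<Rightarrow> real" where
  "moment_bound P = exp 2 * (1 + 2 * (P * sqrt 2)) * (2 + 2 * (P * sqrt 2))"

definition transport_const :: "real \<Rightarrow> real" where
  "transport_const P = 16 * (3 / 2 + moment_bound P)\<^sup>2 * chaining_const\<^sup>2 * P\<^sup>2"

lemma moment_bound_nonneg: "0 \<le> P \<Longrightarrow> 0 \<le> moment_bound P"
  by (simp add: moment_bound_def)

text \<open>The anchor \<open>\<omega>\<^sub>0\<close> is an outcome with \<open>Y \<omega>\<^sub>0 \<le> 2 + 2 P \<surd>2\<close>; one exists since the mean of \<open>Y\<close> is smaller
  than this. With \<open>Q\<close> the constant in front of \<open>1 + ln Y\<close>, the distance to the anchor path satisfies
  \<open>d\<^sup>2 \<le> 8 Q (2 + ln (Y \<omega>\<^sub>0) + ln Y)\<close>, so that \<open>exp (d\<^sup>2 / (8 Q)) \<le> e\<^sup>2 (Y \<omega>\<^sub>0) Y\<close> is integrable.\<close>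
theorem sde_transport_ineq:
  fixes X :: "real \<Rightarrow> 'w \<Rightarrow> real ^ 'd" and \<sigma> :: "real \<Rightarrow> real ^ 'm ^ 'd" and b :: "real ^ 'd \<Rightarrow> real ^ 'd"
  assumes M: "prob_space M" and H: "1 / 2 \<le> H" and T: "0 < T"
    and b: "Lb-lipschitz_on UNIV b" and LT: "Lb * T \<le> 1 / 2"
    and B: "fractional_brownian_motion M H T B" and X: "sde_solution M F T x b \<sigma> B X"
    and Xm: "\<And>t. t \<in> {0..T} \<Longrightarrow> X t \<in> borel_measurable M"
    and \<sigma>: "\<And>t. t \<in> {0..T} \<Longrightarrow> norm (\<sigma> t) \<le> L" and L: "0 \<le> L" and A: "L * T powr H \<le> A" "0 < A"
  shows "transport_ineq 1 (transport_const (real CARD('d \<times> 'm)) * A\<^sup>2) (path_space T) (path_law M T X)"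
proof -
  interpret prob_space M by fact
  define P where "P = real CARD('d \<times> 'm)"
  have P: "0 < P" by (simp add: P_def)
  define c where "c = P * sqrt 2"
  have c: "0 \<le> c" using P by (simp add: c_def)
  define Q where "Q = chaining_const\<^sup>2 * (4 * P\<^sup>2 * A\<^sup>2)"
  have Q: "0 < Q" using P A chaining_const_pos by (simp add: Q_def)
  have cb: "continuous_on UNIV b" using b by (rule lipschitz_on_continuous_on)
  have cX: "\<And>\<omega>. \<omega> \<in> space M \<Longrightarrow> continuous_on {0..T} (\<lambda>t. X t \<omega>)"
    using X unfolding sde_solution_def by auto
  let ?z = "\<lambda>\<omega>. driving_path b (\<lambda>t. X t \<omega>)"
  obtain Y where Ym [measurable]: "Y \<in> borel_measurable M" and Y1: "\<And>\<omega>. 1 \<le> Y \<omega>"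
    and iY: "(\<integral>\<^sup>+\<omega>. ennreal (Y \<omega>) \<partial>M) \<le> ennreal (1 + 2 * c)"
    and bd: "AE \<omega> in M. \<forall>t\<in>{0..T}. (norm (?z \<omega> t - x))\<^sup>2 \<le> Q * (1 + ln (Y \<omega>))"
    using sde_exponential_bound[OF M H T cb B X \<sigma> L A] unfolding P_def c_def Q_def by blast
  obtain \<omega>0 where \<omega>0: "\<omega>0 \<in> space M" "Y \<omega>0 \<le> 2 + 2 * c"
    "\<And>t. t \<in> {0..T} \<Longrightarrow> (norm (?z \<omega>0 t - x))\<^sup>2 \<le> Q * (1 + ln (Y \<omega>0))"
    using nn_integral_le_imp_ex_le[OF iY _ _ bd, of "2 + 2 * c"] c by auto
  define \<gamma> where "\<gamma> \<omega> = (\<lambda>t\<in>{0..T}. X t \<omega>)" for \<omega>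
  have \<gamma>p: "\<gamma> \<omega> \<in> paths T" if "\<omega> \<in> space M" for \<omega>
    unfolding \<gamma>_def by (intro restrict_in_paths cX that)
  have \<gamma>m [measurable]: "\<gamma> \<in> M \<rightarrow>\<^sub>M metric_borel (path_space T)"
    by (rule measurable_into_path_space[OF T \<gamma>p]) (use Xm in \<open>auto simp: \<gamma>_def\<close>)
  define \<alpha> where "\<alpha> = 1 / (8 * Q)"
  have \<alpha>: "0 < \<alpha>" using Q by (simp add: \<alpha>_def)
  have x0: "\<gamma> \<omega>0 \<in> mspace (path_space T)" using \<gamma>p[OF \<omega>0(1)] T by (simp add: mspace_path_space)
  note dm = measurable_dist_path_space[OF T, where 'a = "real ^ 'd"]
  have mom: "AE \<omega> in M. ennreal (exp (\<alpha> * (d_infty T (\<gamma> \<omega>0) (\<gamma> \<omega>))\<^sup>2)) \<le> ennreal (exp 2 * (2 + 2 * c)) * ennreal (Y \<omega>)"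
    using bd AE_space
  proof eventually_elim
    case (elim \<omega>)
    define p q where "p = sqrt (Q * (1 + ln (Y \<omega>0)))" and "q = sqrt (Q * (1 + ln (Y \<omega>)))"
    have p2: "p\<^sup>2 = Q * (1 + ln (Y \<omega>0))" and q2: "q\<^sup>2 = Q * (1 + ln (Y \<omega>))"
      using Q Y1[of \<omega>] Y1[of \<omega>0] by (auto simp: p_def q_def)
    have "d_infty T (\<gamma> \<omega>0) (\<gamma> \<omega>) \<le> 2 * (p + q)"
      unfolding \<gamma>_def
    proof (rule solution_map_lipschitz[OF T cX[OF \<omega>0(1)] cX[OF elim(2)] b LT])
      fix t assume t: "t \<in> {0..T}"
      have "norm (?z \<omega>0 t - x) \<le> p" "norm (?z \<omega> t - x) \<le> q"
        using \<omega>0(3)[OF t] elim(1) t by (auto simp: p_def q_def intro: real_le_rsqrt)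
      then have "norm ((?z \<omega>0 t - x) - (?z \<omega> t - x)) \<le> p + q"
        by (rule norm_triangle_le_diff[OF add_mono])
      then show "norm ((X t \<omega>0 - integral {0..t} (\<lambda>s. b (X s \<omega>0))) - (X t \<omega> - integral {0..t} (\<lambda>s. b (X s \<omega>)))) \<le> p + q"
        unfolding driving_path_def by (simp only: diff_diff_eq2 diff_add_cancel)
    qed
    moreover have "0 \<le> d_infty T (\<gamma> \<omega>0) (\<gamma> \<omega>)"
      by (rule Metric_space.nonneg[OF Metric_space_paths]) (use T in simp)
    ultimately have "(d_infty T (\<gamma> \<omega>0) (\<gamma> \<omega>))\<^sup>2 \<le> (2 * (p + q))\<^sup>2" by (intro power_mono)
    also have "\<dots> \<le> 8 * (p\<^sup>2 + q\<^sup>2)"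
      using sum_squares_bound[of p q] by (simp add: power2_eq_square algebra_simps)
    also have "\<dots> = 8 * Q * (2 + ln (Y \<omega>0) + ln (Y \<omega>))" unfolding p2 q2 by (simp add: algebra_simps)
    finally have "\<alpha> * (d_infty T (\<gamma> \<omega>0) (\<gamma> \<omega>))\<^sup>2 \<le> 2 + ln (Y \<omega>0) + ln (Y \<omega>)"
      using Q by (simp add: \<alpha>_def field_simps)
    then have "exp (\<alpha> * (d_infty T (\<gamma> \<omega>0) (\<gamma> \<omega>))\<^sup>2) \<le> exp (2 + ln (Y \<omega>0) + ln (Y \<omega>))"
      by simp
    also have "\<dots> = exp 2 * Y \<omega>0 * Y \<omega>"
      using Y1[of \<omega>0] Y1[of \<omega>] by (simp add: exp_add)
    also have "\<dots> \<le> exp 2 * (2 + 2 * c) * Y \<omega>"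
      using \<omega>0(2) Y1[of \<omega>] by (intro mult_right_mono mult_left_mono) auto
    finally show ?case using c Y1[of \<omega>] by (simp add: flip: ennreal_mult)
  qed
  have law: "path_law M T X = distr M (metric_borel (path_space T)) \<gamma>"
    unfolding path_law_def \<gamma>_def[abs_def] ..
  have x0': "\<gamma> \<omega>0 \<in> space (metric_borel (path_space T))" using x0 by simp
  have [measurable]: "(\<lambda>f. mdist (path_space T) (\<gamma> \<omega>0) f) \<in> borel_measurable (metric_borel (path_space T))"
    using measurable_compose[OF measurable_Pair1'[OF x0'] dm] by simp
  have "transport_ineq 1 ((3 / 2 + moment_bound P)\<^sup>2 / (2 * \<alpha>)) (path_space T) (path_law M T X)"
  proof (rule transport_ineq_of_exp_moment[OF _ _ x0 dm \<alpha>])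
    show "prob_space (path_law M T X)" unfolding law by (rule prob_space_distr) measurable
    show "sets (path_law M T X) = sets (metric_borel (path_space T))" by (simp add: law)
    show "0 \<le> moment_bound P" using P by (intro moment_bound_nonneg) auto
    have "(\<integral>\<^sup>+f. ennreal (exp (\<alpha> * (mdist (path_space T) (\<gamma> \<omega>0) f)\<^sup>2)) \<partial>path_law M T X) =
      (\<integral>\<^sup>+\<omega>. ennreal (exp (\<alpha> * (mdist (path_space T) (\<gamma> \<omega>0) (\<gamma> \<omega>))\<^sup>2)) \<partial>M)"
      unfolding law by (rule nn_integral_distr) measurable
    also have "\<dots> \<le> (\<integral>\<^sup>+\<omega>. ennreal (exp 2 * (2 + 2 * c)) * ennreal (Y \<omega>) \<partial>M)"
      using mom T by (intro nn_integral_mono_AE) (simp add: mdist_path_space)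
    also have "\<dots> = ennreal (exp 2 * (2 + 2 * c)) * (\<integral>\<^sup>+\<omega>. ennreal (Y \<omega>) \<partial>M)"
      by (rule nn_integral_cmult) measurable
    also have "\<dots> \<le> ennreal (exp 2 * (2 + 2 * c)) * ennreal (1 + 2 * c)"
      by (intro mult_left_mono iY) simp
    also have "\<dots> = ennreal (moment_bound P)"
      using c by (subst ennreal_mult[symmetric]) (auto simp: moment_bound_def c_def mult_ac)
    finally show "(\<integral>\<^sup>+f. ennreal (exp (\<alpha> * (mdist (path_space T) (\<gamma> \<omega>0) f)\<^sup>2)) \<partial>path_law M T X) \<le> ennreal (moment_bound P)" .
  qed
  also have "(3 / 2 + moment_bound P)\<^sup>2 / (2 * \<alpha>) = transport_const P * A\<^sup>2"
    by (simp add: \<alpha>_def Q_def transport_const_def)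
  finally show ?thesis unfolding P_def .
qed

theorem theorem1:
  shows "\<exists>K>0. \<forall>(H::real) (\<beta>::real) (T::real) (L\<^sub>b::real) (x :: real ^ 'd)
      (b :: real ^ 'd \<Rightarrow> real ^ 'd) (\<sigma> :: real \<Rightarrow> real ^ 'm ^ 'd)
      (M :: 'w measure) (F :: real \<Rightarrow> 'w measure)
      (B :: real \<Rightarrow> 'w \<Rightarrow> real ^ 'm) (X :: real \<Rightarrow> 'w \<Rightarrow> real ^ 'd).
      1 / 2 < H \<and> H < 1 \<and>
      L\<^sub>b-lipschitz_on UNIV b \<and>
      1 - H < \<beta> \<and> \<beta> \<le> 1 \<and> \<sigma> \<in> holder_space \<beta> T \<and>
      0 < T \<and> T \<le> 1 \<and> (0 < L\<^sub>b \<longrightarrow> T \<le> 1 / (2 * L\<^sub>b)) \<and>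
      complete_filtered_prob_space M F \<and>
      fractional_brownian_motion M H T B \<and> adapted F T B \<and>
      sde_solution M F T x b \<sigma> B X
      \<longrightarrow> transport_ineq 1 (K * (holder_norm \<beta> T \<sigma>)\<^sup>2 * T powr (2 * H)) (path_space T)
            (path_law M T X)"
proof -
  let ?P = "real CARD('d \<times> 'm)"
  let ?K = "transport_const ?P"
  have K: "0 < ?K"
    using chaining_const_pos moment_bound_nonneg[of ?P] by (simp add: transport_const_def)
  show ?thesis
  proof (intro exI[of _ ?K] conjI K allI impI, elim conjE)
    fix H \<beta> T L\<^sub>b :: real and x :: "real ^ 'd" and b :: "real ^ 'd \<Rightarrow> real ^ 'd" and \<sigma> :: "real \<Rightarrow> real ^ 'm ^ 'd"
      and M :: "'w measure" and F :: "real \<Rightarrow> 'w measure" and B :: "real \<Rightarrow> 'w \<Rightarrow> real ^ 'm" and X :: "real \<Rightarrow> 'w \<Rightarrow> real ^ 'd"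
    assume H: "1 / 2 < H" "H < 1" and b: "L\<^sub>b-lipschitz_on UNIV b" and \<beta>: "1 - H < \<beta>" "\<beta> \<le> 1"
      and \<sigma>: "\<sigma> \<in> holder_space \<beta> T" and T: "0 < T" "T \<le> 1" "0 < L\<^sub>b \<longrightarrow> T \<le> 1 / (2 * L\<^sub>b)"
      and M: "complete_filtered_prob_space M F" and B: "fractional_brownian_motion M H T B" "adapted F T B"
      and X: "sde_solution M F T x b \<sigma> B X"
    let ?n = "holder_norm \<beta> T \<sigma>"
    let ?C = "?K * ?n\<^sup>2 * T powr (2 * H)"
    have n: "norm (\<sigma> t) \<le> ?n" if "t \<in> {0..T}" for t
      using \<beta> H by (intro holder_space_norm_bound[OF \<sigma> _ T(1) that]) simp
    have n0: "0 \<le> ?n" using order_trans[OF norm_ge_zero n[of 0]] T by simp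
    have "0 \<le> L\<^sub>b" using b by (rule lipschitz_on_nonneg)
    then have LT: "L\<^sub>b * T \<le> 1 / 2" using T by (cases "L\<^sub>b = 0") (auto simp: field_simps)
    have pM: "prob_space M" using M by (simp add: complete_filtered_prob_space_def)
    have Xm: "X t \<in> borel_measurable M" if "t \<in> {0..T}" for t
    proof -
      have "X t \<in> borel_measurable (F t)" using X that by (simp add: sde_solution_def adapted_def)
      moreover have "subalgebra M (F t)" using M by (simp add: complete_filtered_prob_space_def)
      ultimately show ?thesis by (rule measurable_from_subalg[rotated])
    qed
    show "transport_ineq 1 ?C (path_space T) (path_law M T X)"
    proof (rule transport_ineq_closed)
      show "0 \<le> ?C" using K by simp
      fix C' assume C': "?C < C'"
      \<comment> \<open>The strict inequality leaves room for a positive scale even if the noise vanishes.\<close>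
      define A where "A = sqrt (C' / ?K)"
      have "0 \<le> ?C" using K by simp
      then have C0: "0 < C'" using C' by linarith
      have A: "0 < A" "?K * A\<^sup>2 = C'" using C0 K by (auto simp: A_def)
      have "(?n * T powr H)\<^sup>2 = ?n\<^sup>2 * T powr (2 * H)"
        using T by (simp add: power_mult_distrib powr_power mult.commute)
      also have "\<dots> \<le> C' / ?K" using C' K by (simp add: field_simps)
      finally have "?n * T powr H \<le> A" unfolding A_def by (rule real_le_rsqrt)
      then show "transport_ineq 1 C' (path_space T) (path_law M T X)"
        using sde_transport_ineq[OF pM less_imp_le[OF H(1)] T(1) b LT B(1) X Xm n n0 _ A(1)] A(2) by simp
    qed
  qed
qed

end
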